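(* With probability one there exists $n_0$ such that for every $n\ge n_0$ the function $\mathbb R^4\ni(\alpha',\mu'_\varepsilon,\theta_1',\theta_2')\mapsto Q_n(\mathbf Y_n;\alpha',\mu'_\varepsilon,\theta_1',\theta_2')$ has a unique global minimizer, denoted $(\hat\alpha_n,\hat\mu_{\varepsilon,n},\hat\theta_{1,n},\hat\theta_{2,n})$. Moreover, for every $(\alpha,\mu_\varepsilon,\theta_1,\theta_2)\in(0,1)\times(0,\infty)\times\mathbb N^2$, almost surely $\hat\alpha_n\to\alpha$, $\hat\mu_{\varepsilon,n}\to\mu_\varepsilon$ and, for $i=1,2$, $$\hat\theta_{i,n}\to Y_{s_i}-\frac{\alpha}{1+\alpha^2}(Y_{s_i-1}+Y_{s_i+1})-\frac{1-\alpha}{1+\alpha^2}\mu_\varepsilon .$$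
   Context: INAR(1) process: Let $\alpha\in(0,1)$. Let $(\varepsilon_k)_{k\in\mathbb N}$ be i.i.d. non-negative integer-valued random variables with $\mathbb E\varepsilon_1^2<\infty$ and $\mathbb P(\varepsilon_1\ne 0)>0$; write $\mu_\varepsilon=\mathbb E\varepsilon_1$. For each $k\in\mathbb N$ let $(\xi_{k,j})_{j\in\mathbb N}$ be i.i.d. Bernoulli random variables with mean $\alpha$, these sequences being mutually independent and independent of $(\varepsilon_k)$. Let $X_0$ be a non-negative integer-valued random variable with $\mathbb E X_0^2<\infty$, independent of all $\xi_{k,j}$ and $\varepsilon_k$, and set $X_k=\sum_{j=1}^{X_{k-1}}\xi_{k,j}+\varepsilon_k$ for $k\in\mathbb N$. Two non-neighbouring additive outliers: fix known $s_1,s_2\in\mathbb N$ with $s_1<s_2-1$ and $\theta_1,\theta_2\in\mathbb N$; $Y_k=X_k+\delta_{k,s_1}\theta_1+\delta_{k,s_2}\theta_2$, $k\in\mathbb Z_+$; $\mathbf Y_n=(Y_0,\dots,Y_n)$. For $n\ge\max(5,s_2+1)$, $$Q_n(\mathbf y_n;\alpha',\mu'_\varepsilon,\theta_1',\theta_2')=\sum_{\substack{k=1\\k\notin\{s_1,s_1+1,s_2,s_2+1\}}}^n(y_k-\alpha'y_{k-1}-\mu'_\varepsilon)^2+\sum_{i=1}^2\Big[(y_{s_i}-\alpha'y_{s_i-1}-\mu'_\varepsilon-\theta_i')^2+(y_{s_i+1}-\alpha'y_{s_i}-\mu'_\varepsilon+\alpha'\theta_i')^2\Big].$$ *)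

theory Defs
  imports "HOL-Probability.Probability"
begin

datatype inar_idx = Init | Eps nat | Xi nat nat

definition inar_index_set :: "inar_idx set" where
  "inar_index_set = {Init} \<union> {Eps k | k. 1 \<le> k} \<union> {Xi k j | k j. 1 \<le> k \<and> 1 \<le> j}"

definition inar_family ::
  "('w \<Rightarrow> nat) \<Rightarrow> (nat \<Rightarrow> 'w \<Rightarrow> nat) \<Rightarrow> (nat \<Rightarrow> nat \<Rightarrow> 'w \<Rightarrow> nat) \<Rightarrow> inar_idx \<Rightarrow> 'w \<Rightarrow> nat" where
  "inar_family X0 eps xi i = (case i of Init \<Rightarrow> X0 | Eps k \<Rightarrow> eps k | Xi k j \<Rightarrow> xi k j)"

primrec inarX ::
  "('w \<Rightarrow> nat) \<Rightarrow> (nat \<Rightarrow> 'w \<Rightarrow> nat) \<Rightarrow> (nat \<Rightarrow> nat \<Rightarrow> 'w \<Rightarrow> nat) \<Rightarrow> nat \<Rightarrow> 'w \<Rightarrow> nat" where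
  "inarX X0 eps xi 0 \<omega> = X0 \<omega>"
| "inarX X0 eps xi (Suc k) \<omega> =
     (\<Sum>j=1..inarX X0 eps xi k \<omega>. xi (Suc k) j \<omega>) + eps (Suc k) \<omega>"

definition inarY ::
  "('w \<Rightarrow> nat) \<Rightarrow> (nat \<Rightarrow> 'w \<Rightarrow> nat) \<Rightarrow> (nat \<Rightarrow> nat \<Rightarrow> 'w \<Rightarrow> nat) \<Rightarrow>
   nat \<Rightarrow> nat \<Rightarrow> nat \<Rightarrow> nat \<Rightarrow> nat \<Rightarrow> 'w \<Rightarrow> nat" where
  "inarY X0 eps xi s1 s2 \<theta>1 \<theta>2 k \<omega> =
     inarX X0 eps xi k \<omega> + (if k = s1 then \<theta>1 else 0) + (if k = s2 then \<theta>2 else 0)"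

definition Qn :: "nat \<Rightarrow> nat \<Rightarrow> nat \<Rightarrow> (nat \<Rightarrow> real) \<Rightarrow> real \<Rightarrow> real \<Rightarrow> real \<Rightarrow> real \<Rightarrow> real" where
  "Qn s1 s2 n y a m t1 t2 =
     (\<Sum>k\<in>{1..n} - {s1, s1+1, s2, s2+1}. (y k - a * y (k-1) - m)\<^sup>2)
     + ((y s1 - a * y (s1-1) - m - t1)\<^sup>2 + (y (s1+1) - a * y s1 - m + a * t1)\<^sup>2)
     + ((y s2 - a * y (s2-1) - m - t2)\<^sup>2 + (y (s2+1) - a * y s2 - m + a * t2)\<^sup>2)"

definition Qn4 :: "nat \<Rightarrow> nat \<Rightarrow> nat \<Rightarrow> (nat \<Rightarrow> real) \<Rightarrow> real \<times> real \<times> real \<times> real \<Rightarrow> real" where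
  "Qn4 s1 s2 n y p = (case p of (a, m, t1, t2) \<Rightarrow> Qn s1 s2 n y a m t1 t2)"

definition CLSE :: "nat \<Rightarrow> nat \<Rightarrow> nat \<Rightarrow> (nat \<Rightarrow> real) \<Rightarrow> real \<times> real \<times> real \<times> real" where
  "CLSE s1 s2 n y = (THE p. \<forall>q. Qn4 s1 s2 n y p \<le> Qn4 s1 s2 n y q)"

end

theory Submission
  imports Defs "HOL-Real_Asymp.Real_Asymp"
begin

text \<open>With \<open>z k = X (k+1) - \<alpha> X k - \<mu>\<close>, the objective is a sum of squares whose Hessian in
  \<open>(a, m)\<close> grows linearly in \<open>n\<close>, plus two outlier terms that do not depend on \<open>n\<close>. Comparing with the
  value at \<open>(\<alpha>, \<mu>, 0, 0)\<close> confines minimizers to a neighbourhood of \<open>(\<alpha>, \<mu>)\<close> that shrinks as soon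
  as the averages of \<open>z k\<close> and \<open>z k * X k\<close> vanish and the Gram matrix of \<open>(X k, 1)\<close> is bounded below;
  the outlier sizes are then explicit functions of \<open>(a, m)\<close>, and strong convexity in \<open>(a, m)\<close> beats
  the bounded nonconvexity of the outlier terms. No ergodic theorem is needed: the two averages are
  normalised martingales, and the Gram bound follows because the integer-valued path satisfies
  \<open>X (k+1) \<noteq> X k\<close> with conditional probability bounded below.\<close>

section \<open>The least squares problem along a fixed path\<close>

text \<open>Only second moments are assumed and \<open>X0\<close> is arbitrary, so neither
  stationarity nor square integrability of \<open>X k * z k\<close> is available. The argument
  therefore runs along one fixed path and asks of it only three facts that hold almost surely:
  frequent jumps and two vanishing averages. The four summands that see an outlier are left out of
  the main sum; on the remaining ones the observed path agrees with the true one, so contamination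
  never reaches the Gram matrix or the averages. The form \<open>(a * x + b)^2\<close>, summed along
  the path, degenerates in \<open>a\<close> only when the path hugs the constant
  \<open>- b / a\<close>; at each jump of an integer path one of the two values is at distance at
  least 1/2 from any given constant. An outlier size occurs in just two residuals, however large
  \<open>n\<close> is. Its estimate is a function of three observations and of the estimates of
  \<open>\<alpha>\<close> and \<open>\<mu>\<close>, which explains why it has a random limit rather
  than the true size.\<close>

lemma square_sum_le: "(u + v)\<^sup>2 \<le> 2 * u\<^sup>2 + 2 * v\<^sup>2" for u v :: real
  using zero_le_power2[of "u - v"] by (simp add: power2_eq_square algebra_simps)

text \<open>For \<open>a\<close> the jumps are used: two values at distance at least 1 cannot both
  be close to the same \<open>c\<close>, and \<open>c = - b / a\<close> is arbitrary. For
  \<open>b\<close>, the triangle inequality bounds \<open>\<bar>b\<bar>\<close> by the mean of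
  \<open>\<bar>a * x (k - 1) + b\<bar>\<close> plus \<open>\<bar>a\<bar>\<close> times the bounded
  mean of \<open>\<bar>x k\<bar>\<close>, and \<open>a\<close> is controlled already.\<close>

lemma gram_lower_bound:
  fixes x :: "nat \<Rightarrow> real" and E :: "nat set"
  assumes E: "finite E" and p: "p > 0"
    and jump: "\<And>k. x (Suc k) \<noteq> x k \<Longrightarrow> 1 \<le> \<bar>x (Suc k) - x k\<bar>"
    and freq: "\<forall>\<^sub>F n in sequentially. p * real n \<le> (\<Sum>k<n. of_bool (x (Suc k) \<noteq> x k))"
    and avg: "\<forall>\<^sub>F n in sequentially. (\<Sum>k<n. \<bar>x k\<bar>) \<le> B * real n"
  shows "\<exists>l>0. \<forall>\<^sub>F n in sequentially. \<forall>a b.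
           l * real n * (a\<^sup>2 + b\<^sup>2) \<le> (\<Sum>k\<in>{1..n} - E. (a * x (k - 1) + b)\<^sup>2)"
proof -
  \<comment> \<open>Leaving out the summand \<open>e\<close> spoils the two jumps that involve
    \<open>x (e - 1)\<close>, hence \<open>2 * card E\<close>. The jump at \<open>n\<close> is lost
    as well, since it would need the summand \<open>n + 1\<close>.\<close>
  define N where "N = 1 + 2 * real (card E)"
  define K where "K n = {1..n} - E" for n
  have finK: "finite (K n)" for n by (simp add: K_def)
  have centred: "p * real n - N \<le> 4 * (\<Sum>k\<in>K n. (x (k - 1) - c)\<^sup>2)"
    if fr: "p * real n \<le> (\<Sum>k<n. of_bool (x (Suc k) \<noteq> x k))" for n c
  proof -
    define T where "T = {k\<in>{1..<n}. k \<notin> E \<and> Suc k \<notin> E}"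
    let ?g = "\<lambda>k. of_bool (x k \<noteq> x (k - 1)) :: real"
    have "(\<Sum>k<n. of_bool (x (Suc k) \<noteq> x k)) = (\<Sum>k\<in>{1..n}. ?g k)"
      by (rule sum.reindex_bij_witness[of _ "\<lambda>k. k - 1" Suc]) auto
    also have "\<dots> = sum ?g T + sum ?g ({1..n} - T)"
      by (subst sum.subset_diff[of T]) (auto simp: T_def)
    also have "sum ?g ({1..n} - T) \<le> real (card ({1..n} - T))"
      using sum_bounded_above[of "{1..n} - T" ?g 1] by auto
    also have "card ({1..n} - T) \<le> card (insert n (E \<union> (\<lambda>k. k - 1) ` E))"
    proof (rule card_mono)
      show "{1..n} - T \<subseteq> insert n (E \<union> (\<lambda>k. k - 1) ` E)"
      proof
        fix k assume k: "k \<in> {1..n} - T"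
        show "k \<in> insert n (E \<union> (\<lambda>k. k - 1) ` E)"
          using k image_eqI[of k "\<lambda>k. k - 1" "Suc k" E] by (auto simp: T_def)
      qed
    qed (use E in auto)
    also have "card (insert n (E \<union> (\<lambda>k. k - 1) ` E)) \<le> Suc (card E + card E)"
      by (metis (no_types, lifting) E card_Un_le card_image_le card_insert_le_m1 diff_Suc_1
          add_left_mono le_trans zero_less_Suc)
    finally have 1: "(\<Sum>k<n. of_bool (x (Suc k) \<noteq> x k)) \<le> sum ?g T + N"
      by (simp add: N_def)
    have "?g k \<le> 2 * (x (Suc k - 1) - c)\<^sup>2 + 2 * (x (k - 1) - c)\<^sup>2" if "k \<in> T" for k
    proof (cases "x k = x (k - 1)")
      case False
      with that jump[of "k - 1"] have "1 \<le> \<bar>x k - x (k - 1)\<bar>" by (auto simp: T_def)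
      then have "1 \<le> (x k - x (k - 1))\<^sup>2" by (metis one_le_power power2_abs)
      also have "\<dots> \<le> (x k - x (k - 1))\<^sup>2 + (x k + x (k - 1) - 2 * c)\<^sup>2" by simp
      also have "\<dots> = 2 * (x k - c)\<^sup>2 + 2 * (x (k - 1) - c)\<^sup>2"
        by (simp add: power2_eq_square algebra_simps)
      finally show ?thesis by simp
    qed simp
    then have "sum ?g T \<le> (\<Sum>k\<in>T. 2 * (x (Suc k - 1) - c)\<^sup>2 + 2 * (x (k - 1) - c)\<^sup>2)"
      by (rule sum_mono)
    also have "\<dots> = 2 * (\<Sum>k\<in>Suc ` T. (x (k - 1) - c)\<^sup>2) + 2 * (\<Sum>k\<in>T. (x (k - 1) - c)\<^sup>2)"
      by (simp add: sum.distrib sum_distrib_left sum.reindex)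
    also have "(\<Sum>k\<in>Suc ` T. (x (k - 1) - c)\<^sup>2) \<le> (\<Sum>k\<in>K n. (x (k - 1) - c)\<^sup>2)"
      by (rule sum_mono2[OF finK]) (auto simp: T_def K_def)
    also have "(\<Sum>k\<in>T. (x (k - 1) - c)\<^sup>2) \<le> (\<Sum>k\<in>K n. (x (k - 1) - c)\<^sup>2)"
      by (rule sum_mono2[OF finK]) (auto simp: T_def K_def)
    finally have "sum ?g T \<le> 4 * (\<Sum>k\<in>K n. (x (k - 1) - c)\<^sup>2)" by simp
    with 1 fr show ?thesis by simp
  qed
  \<comment> \<open>\<open>l1\<close> is what \<open>centred\<close> leaves once
    \<open>2 * N \<le> p * real n\<close>: half of \<open>p\<close>, divided by 4. \<open>c2\<close>
    collects the factor found for \<open>b\<close>, and \<open>l\<close> is chosen so that each of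
    the two coefficients spends at most \<open>Q / 2\<close>.\<close>
  define l1 where "l1 = p / 8"
  have l1: "l1 > 0" using p by (simp add: l1_def)
  define c2 where "c2 = 1 + (B\<^sup>2 + 1) / l1"
  define l where "l = min (l1 / 2) (1 / (16 * c2))"
  have c2: "c2 > 0" using l1 by (auto simp: c2_def intro!: add_pos_nonneg)
  have l: "l > 0" using l1 c2 by (auto simp: l_def)
  have large: "\<forall>\<^sub>F n in sequentially. 2 * N \<le> p * real n \<and> 2 * N \<le> real n \<and> 0 < n"
  proof -
    have "filterlim (\<lambda>n. p * real n) at_top sequentially" using p by real_asymp
    moreover have "filterlim (\<lambda>n. real n) at_top sequentially" by real_asymp
    ultimately show ?thesis
      by (auto simp: filterlim_at_top eventually_conj_iff eventually_gt_at_top)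
  qed
  have "\<forall>\<^sub>F n in sequentially. \<forall>a b.
           l * real n * (a\<^sup>2 + b\<^sup>2) \<le> (\<Sum>k\<in>{1..n} - E. (a * x (k - 1) + b)\<^sup>2)"
    using freq avg large
  proof eventually_elim
    case (elim n)
    show ?case
    proof (intro allI)
      fix a b
      define Q where "Q = (\<Sum>k\<in>K n. (a * x (k - 1) + b)\<^sup>2)"
      have n: "real n > 0" using elim by simp
      have Qa: "l1 * real n * a\<^sup>2 \<le> Q"
      proof (cases "a = 0")
        case False
        have "Q = a\<^sup>2 * (\<Sum>k\<in>K n. (x (k - 1) - (- b / a))\<^sup>2)"
          unfolding Q_def sum_distrib_left using False
          by (intro sum.cong) (auto simp: power2_eq_square field_simps)
        moreover have "l1 * real n \<le> (\<Sum>k\<in>K n. (x (k - 1) - (- b / a))\<^sup>2)"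
          using centred[OF elim(1), of "- b / a"] elim(3) by (simp add: l1_def)
        ultimately show ?thesis
          by (metis mult.commute mult_left_mono zero_le_power2)
      qed (auto simp: Q_def intro: sum_nonneg)
      have card: "real n / 2 \<le> real (card (K n))" "real (card (K n)) \<le> real n"
      proof -
        have "card (K n) \<ge> card {1..n} - card E"
          unfolding K_def by (rule diff_card_le_card_Diff[OF E])
        then have "real (card (K n)) \<ge> real n - real (card E)" by simp
        then show "real n / 2 \<le> real (card (K n))" using elim(3) by (simp add: N_def)
        have "card (K n) \<le> card {1..n}" unfolding K_def by (intro card_mono) auto
        then show "real (card (K n)) \<le> real n" by simp
      qed
      have "(\<Sum>k\<in>K n. \<bar>x (k - 1)\<bar>) \<le> (\<Sum>k\<in>{1..n}. \<bar>x (k - 1)\<bar>)"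
        by (rule sum_mono2) (auto simp: K_def)
      also have "\<dots> = (\<Sum>k<n. \<bar>x k\<bar>)"
        by (rule sum.reindex_bij_witness[of _ Suc "\<lambda>k. k - 1"]) auto
      finally have xb: "(\<Sum>k\<in>K n. \<bar>x (k - 1)\<bar>) \<le> B * real n" using elim(2) by simp
      have "(\<Sum>k\<in>K n. \<bar>b\<bar>) \<le> (\<Sum>k\<in>K n. \<bar>a * x (k - 1) + b\<bar> + \<bar>a\<bar> * \<bar>x (k - 1)\<bar>)"
        by (rule sum_mono) (simp add: abs_mult[symmetric])
      then have "real (card (K n)) * \<bar>b\<bar>
          \<le> (\<Sum>k\<in>K n. \<bar>a * x (k - 1) + b\<bar>) + \<bar>a\<bar> * (\<Sum>k\<in>K n. \<bar>x (k - 1)\<bar>)"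
        by (simp add: sum.distrib sum_distrib_left)
      moreover have "real n / 2 * \<bar>b\<bar> \<le> real (card (K n)) * \<bar>b\<bar>"
        using card(1) by (rule mult_right_mono) simp
      moreover have "\<bar>a\<bar> * (\<Sum>k\<in>K n. \<bar>x (k - 1)\<bar>) \<le> \<bar>a\<bar> * (B * real n)"
        using xb by (rule mult_left_mono) simp
      ultimately have b1: "real n / 2 * \<bar>b\<bar> \<le> (\<Sum>k\<in>K n. \<bar>a * x (k - 1) + b\<bar>) + \<bar>a\<bar> * (B * real n)"
        by linarith
      have "(\<Sum>k\<in>K n. \<bar>a * x (k - 1) + b\<bar>)\<^sup>2 \<le> real (card (K n)) * Q"
        using Cauchy_Schwarz_ineq_sum[of "\<lambda>_. 1" "\<lambda>k. \<bar>a * x (k - 1) + b\<bar>" "K n"]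
        by (simp add: Q_def)
      also have "\<dots> \<le> real n * Q"
        using card(2) by (rule mult_right_mono) (auto simp: Q_def intro: sum_nonneg)
      finally have cs: "(\<Sum>k\<in>K n. \<bar>a * x (k - 1) + b\<bar>)\<^sup>2 \<le> real n * Q" .
      have "(real n / 2 * \<bar>b\<bar>)\<^sup>2 \<le> ((\<Sum>k\<in>K n. \<bar>a * x (k - 1) + b\<bar>) + \<bar>a\<bar> * (B * real n))\<^sup>2"
        using b1 by (rule power_mono) simp
      also have "\<dots> \<le> 2 * (\<Sum>k\<in>K n. \<bar>a * x (k - 1) + b\<bar>)\<^sup>2 + 2 * (\<bar>a\<bar> * (B * real n))\<^sup>2"
        by (rule square_sum_le)
      also have "\<dots> \<le> 2 * (real n * Q) + 2 * (\<bar>a\<bar> * (B * real n))\<^sup>2" using cs by simp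
      also have "(\<bar>a\<bar> * (B * real n))\<^sup>2 = B\<^sup>2 * real n * (real n * a\<^sup>2)"
        by (simp add: power2_eq_square abs_mult_self_eq algebra_simps)
      \<comment> \<open>The contribution of \<open>a\<close> is traded back for \<open>Q\<close> by
        means of \<open>Qa\<close>, so that only \<open>Q\<close> remains on the right.\<close>
      also have "\<dots> \<le> B\<^sup>2 * real n * (Q / l1)"
        using Qa l1 by (intro mult_left_mono) (auto simp: field_simps)
      also have "2 * (real n * Q) + 2 * (B\<^sup>2 * real n * (Q / l1)) \<le> real n * (2 * c2 * Q)"
      proof -
        have "0 \<le> Q" by (simp add: Q_def sum_nonneg)
        then have "0 \<le> real n * (2 * Q / l1)" using l1 by simp
        then show ?thesis by (simp add: c2_def algebra_simps add_divide_distrib)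
      qed
      finally have "real n * (real n * b\<^sup>2) \<le> real n * (8 * c2 * Q)"
        by (simp add: power_mult_distrib power_divide) (simp add: power2_eq_square algebra_simps)
      then have "real n * b\<^sup>2 \<le> 8 * c2 * Q" using n by simp
      then have Qb: "1 / (16 * c2) * real n * b\<^sup>2 \<le> Q / 2"
        using c2 by (simp add: field_simps)
      have "l * real n * a\<^sup>2 \<le> l1 / 2 * real n * a\<^sup>2"
        by (intro mult_right_mono) (auto simp: l_def)
      moreover have "l * real n * b\<^sup>2 \<le> 1 / (16 * c2) * real n * b\<^sup>2"
        by (intro mult_right_mono) (auto simp: l_def)
      ultimately have "l * real n * (a\<^sup>2 + b\<^sup>2) \<le> Q"
        using Qa Qb by (simp add: algebra_simps)
      show "l * real n * (a\<^sup>2 + b\<^sup>2) \<le> (\<Sum>k\<in>{1..n} - E. (a * x (k - 1) + b)\<^sup>2)"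
        using \<open>l * real n * (a\<^sup>2 + b\<^sup>2) \<le> Q\<close> by (simp add: Q_def K_def)
    qed
  qed
  with l show ?thesis by blast
qed

lemma abs_mult_le_sum_squares: "\<bar>u * v\<bar> \<le> u\<^sup>2 + v\<^sup>2" for u v :: real
proof (rule abs_leI)
  have "0 \<le> (u - v)\<^sup>2" "0 \<le> (u + v)\<^sup>2" "0 \<le> u\<^sup>2" "0 \<le> v\<^sup>2" by simp_all
  then show "u * v \<le> u\<^sup>2 + v\<^sup>2" "- (u * v) \<le> u\<^sup>2 + v\<^sup>2"
    unfolding power2_diff power2_sum by linarith+
qed

text \<open>Around \<open>(\<alpha>, \<mu>)\<close> the difference
  \<open>S n a m - S n \<alpha> \<mu>\<close> is the Gram form minus a linear term with coefficients
  of size \<open>real n * e n\<close>. The form grows like \<open>n\<close> times the squared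
  deviation, so a bounded excess \<open>C\<close> confines the deviation. The slack \<open>C\<close>
  makes room for the cost of the outlier terms.\<close>

lemma least_squares_sublevel:
  fixes y :: "nat \<Rightarrow> real" and E :: "nat set" and C \<alpha> \<mu> l :: real
  defines "K \<equiv> \<lambda>n. {1..n} - E"
  defines "S \<equiv> \<lambda>n a m. \<Sum>k\<in>K n. (y k - a * y (k - 1) - m)\<^sup>2"
  assumes l: "l > 0"
    and gram: "\<forall>\<^sub>F n in sequentially. \<forall>a b.
           l * real n * (a\<^sup>2 + b\<^sup>2) \<le> (\<Sum>k\<in>K n. (a * y (k - 1) + b)\<^sup>2)"
    and n1: "(\<lambda>n. (\<Sum>k\<in>K n. y k - \<alpha> * y (k - 1) - \<mu>) / real n) \<longlonglongrightarrow> 0"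
    and n2: "(\<lambda>n. (\<Sum>k\<in>K n. (y k - \<alpha> * y (k - 1) - \<mu>) * y (k - 1)) / real n) \<longlonglongrightarrow> 0"
  obtains \<eta> where "\<eta> \<longlonglongrightarrow> 0"
    "\<forall>\<^sub>F n in sequentially. \<forall>a m. S n a m \<le> S n \<alpha> \<mu> + C \<longrightarrow> (a - \<alpha>)\<^sup>2 + (m - \<mu>)\<^sup>2 \<le> \<eta> n"
proof -
  define z where "z k = y k - \<alpha> * y (k - 1) - \<mu>" for k
  define e where "e n = \<bar>(\<Sum>k\<in>K n. z k) / real n\<bar> + \<bar>(\<Sum>k\<in>K n. z k * y (k - 1)) / real n\<bar>" for n
  have "(\<lambda>n. e n) \<longlonglongrightarrow> \<bar>0\<bar> + \<bar>0\<bar>"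
    unfolding e_def z_def by (intro tendsto_intros n1 n2)
  then have e: "e \<longlonglongrightarrow> 0" by simp
  have ev: "\<forall>\<^sub>F n in sequentially. 2 * e n < l / 2"
    using order_tendstoD(2)[OF e, of "l / 4"] l by (auto elim: eventually_mono)
  define \<eta> where "\<eta> n = 2 / l * (C / real n + 2 * e n)" for n
  have "\<eta> \<longlonglongrightarrow> 2 / l * (0 + 2 * 0)"
    unfolding \<eta>_def by (intro tendsto_intros e)
  then have "\<eta> \<longlonglongrightarrow> 0" by simp
  moreover have "\<forall>\<^sub>F n in sequentially. \<forall>a m. S n a m \<le> S n \<alpha> \<mu> + C \<longrightarrow> (a - \<alpha>)\<^sup>2 + (m - \<mu>)\<^sup>2 \<le> \<eta> n"
    using gram ev eventually_gt_at_top[of 0]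
  proof eventually_elim
    case (elim n)
    show ?case
    proof (intro allI impI)
      fix a m assume le: "S n a m \<le> S n \<alpha> \<mu> + C"
      define u v where "u = a - \<alpha>" and "v = m - \<mu>"
      have n: "real n > 0" using elim by simp
      have "S n a m = (\<Sum>k\<in>K n. (z k)\<^sup>2 + (u * y (k - 1) + v)\<^sup>2
               - 2 * u * (z k * y (k - 1)) - 2 * v * z k)"
        unfolding S_def by (intro sum.cong) (auto simp: z_def u_def v_def power2_eq_square algebra_simps)
      also have "\<dots> = S n \<alpha> \<mu> + (\<Sum>k\<in>K n. (u * y (k - 1) + v)\<^sup>2)
               - 2 * u * (\<Sum>k\<in>K n. z k * y (k - 1)) - 2 * v * (\<Sum>k\<in>K n. z k)"
      proof -
        have "S n \<alpha> \<mu> = (\<Sum>k\<in>K n. (z k)\<^sup>2)" by (simp add: S_def z_def)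
        then show ?thesis by (simp add: sum.distrib sum_subtractf sum_distrib_left)
      qed
      finally have eq: "S n a m = \<dots>" .
      have e1: "\<bar>\<Sum>k\<in>K n. z k * y (k - 1)\<bar> \<le> real n * e n" and e2: "\<bar>\<Sum>k\<in>K n. z k\<bar> \<le> real n * e n"
        using n by (auto simp: e_def abs_divide field_simps)
      have prod_le: "c * t \<le> \<bar>c\<bar> * B" if "\<bar>t\<bar> \<le> B" for c t B :: real
      proof -
        have "c * t \<le> \<bar>c\<bar> * \<bar>t\<bar>" by (simp flip: abs_mult)
        also have "\<dots> \<le> \<bar>c\<bar> * B" using that by (rule mult_left_mono) simp
        finally show ?thesis .
      qed
      have "2 * u * (\<Sum>k\<in>K n. z k * y (k - 1)) \<le> 2 * \<bar>u\<bar> * (real n * e n)"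
          "2 * v * (\<Sum>k\<in>K n. z k) \<le> 2 * \<bar>v\<bar> * (real n * e n)"
        using prod_le[OF e1, of "2 * u"] prod_le[OF e2, of "2 * v"] by (simp_all add: abs_mult)
      \<comment> \<open>A linear term is at most 1 plus the quadratic one. The quadratic share is
        absorbed into the Gram form, which loses at most \<open>l / 2\<close> by \<open>ev\<close>;
        the share 1 becomes the term \<open>2 * e n\<close> of \<open>\<eta>\<close>.\<close>
      moreover have "2 * (\<bar>u\<bar> + \<bar>v\<bar>) * (real n * e n) \<le> 2 * (1 + (u\<^sup>2 + v\<^sup>2)) * (real n * e n)"
      proof -
        have "0 \<le> (\<bar>u\<bar> - 1 / 2)\<^sup>2 + (\<bar>v\<bar> - 1 / 2)\<^sup>2" by simp
        then have "\<bar>u\<bar> + \<bar>v\<bar> \<le> 1 + (u\<^sup>2 + v\<^sup>2)" by (simp add: power2_diff power_divide)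
        then show ?thesis by (intro mult_right_mono) (auto simp: e_def)
      qed
      ultimately have "l * real n * (u\<^sup>2 + v\<^sup>2) \<le> C + 2 * (1 + (u\<^sup>2 + v\<^sup>2)) * (real n * e n)"
        using le eq elim(1)[rule_format, of u v] by (simp add: algebra_simps)
      then have "real n * ((l - 2 * e n) * (u\<^sup>2 + v\<^sup>2)) \<le> real n * (C / real n + 2 * e n)"
        using n by (simp add: algebra_simps)
      then have "(l - 2 * e n) * (u\<^sup>2 + v\<^sup>2) \<le> C / real n + 2 * e n"
        using n by simp
      moreover have "(l / 2) * (u\<^sup>2 + v\<^sup>2) \<le> (l - 2 * e n) * (u\<^sup>2 + v\<^sup>2)"
        using elim(2) by (intro mult_right_mono) auto
      ultimately have "(l / 2) * (u\<^sup>2 + v\<^sup>2) \<le> C / real n + 2 * e n" by linarith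
      then show "(a - \<alpha>)\<^sup>2 + (m - \<mu>)\<^sup>2 \<le> \<eta> n"
        using l by (simp add: \<eta>_def u_def[symmetric] v_def[symmetric] field_simps)
    qed
  qed
  ultimately show thesis by (rule that)
qed

section \<open>The two residuals that contain an outlier\<close>

definition outlier_cost :: "real \<Rightarrow> real \<Rightarrow> real \<Rightarrow> real \<Rightarrow> real \<Rightarrow> real \<Rightarrow> real" where
  "outlier_cost u0 u1 u2 a m t = (u1 - a * u0 - m - t)\<^sup>2 + (u2 - a * u1 - m + a * t)\<^sup>2"

text \<open>Vertex of the parabola in \<open>t\<close> for fixed \<open>(a, m)\<close>;
  \<open>u0\<close>, \<open>u1\<close>, \<open>u2\<close> are the observations before, at and after
  the outlier. The leading coefficient \<open>1 + a\<^sup>2\<close> is positive for every real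
  \<open>a\<close>, so the outlier size is always determined by the other two parameters.\<close>

definition outlier_size :: "real \<Rightarrow> real \<Rightarrow> real \<Rightarrow> real \<Rightarrow> real \<Rightarrow> real" where
  "outlier_size u0 u1 u2 a m = ((u1 - a * u0 - m) - a * (u2 - a * u1 - m)) / (1 + a\<^sup>2)"

lemma outlier_cost_nonneg: "0 \<le> outlier_cost u0 u1 u2 a m t"
  by (simp add: outlier_cost_def)

lemma outlier_cost_complete_square:
  "outlier_cost u0 u1 u2 a m t = (1 + a\<^sup>2) * (t - outlier_size u0 u1 u2 a m)\<^sup>2
     + outlier_cost u0 u1 u2 a m (outlier_size u0 u1 u2 a m)"
proof -
  define A B where "A = u1 - a * u0 - m" and "B = u2 - a * u1 - m"
  define c where "c = 1 + a\<^sup>2"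
  have "c > 0" by (simp add: c_def add_pos_nonneg)
  define s where "s = (A - a * B) / c"
  have s: "c * s = A - a * B" using \<open>c > 0\<close> by (simp add: s_def)
  have "(A - t)\<^sup>2 + (B + a * t)\<^sup>2 - ((A - s)\<^sup>2 + (B + a * s)\<^sup>2)
      = c * t\<^sup>2 - c * s\<^sup>2 - 2 * (A - a * B) * (t - s)"
    by (simp add: c_def power2_eq_square algebra_simps)
  also have "\<dots> = c * (t - s)\<^sup>2"
    unfolding s[symmetric] by (simp add: power2_eq_square algebra_simps)
  finally show ?thesis
    by (simp add: outlier_cost_def outlier_size_def A_def B_def c_def s_def)
qed

lemma outlier_cost_le_imp_eq:
  assumes "outlier_cost u0 u1 u2 a m t \<le> outlier_cost u0 u1 u2 a m (outlier_size u0 u1 u2 a m)"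
  shows "t = outlier_size u0 u1 u2 a m"
proof -
  have "(1 + a\<^sup>2) * (t - outlier_size u0 u1 u2 a m)\<^sup>2 \<le> 0"
    using assms outlier_cost_complete_square[of u0 u1 u2 a m t] by simp
  moreover have "1 + a\<^sup>2 > 0" by (simp add: add_pos_nonneg)
  ultimately show ?thesis by (simp add: mult_le_0_iff)
qed

text \<open>The limit is \<open>outlier_size\<close> at \<open>(\<alpha>, \<mu>)\<close>: in the
  numerator the two contributions of \<open>u1\<close> add up to
  \<open>(1 + \<alpha>\<^sup>2) * u1\<close>, and the denominator cancels there.\<close>

lemma tendsto_outlier_size:
  assumes "(a \<longlongrightarrow> \<alpha>) F" "(m \<longlongrightarrow> \<mu>) F"
  shows "((\<lambda>n. outlier_size u0 u1 u2 (a n) (m n)) \<longlongrightarrow>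
      u1 - \<alpha> / (1 + \<alpha>\<^sup>2) * (u0 + u2) - (1 - \<alpha>) / (1 + \<alpha>\<^sup>2) * \<mu>) F"
proof -
  have nz: "1 + \<alpha>\<^sup>2 \<noteq> 0" by (smt (verit) zero_le_power2)
  have "outlier_size u0 u1 u2 \<alpha> \<mu> = u1 - \<alpha> / (1 + \<alpha>\<^sup>2) * (u0 + u2) - (1 - \<alpha>) / (1 + \<alpha>\<^sup>2) * \<mu>"
  proof -
    have "(u1 - \<alpha> * u0 - \<mu>) - \<alpha> * (u2 - \<alpha> * u1 - \<mu>)
        = u1 * (1 + \<alpha>\<^sup>2) - \<alpha> * (u0 + u2) - (1 - \<alpha>) * \<mu>"
      by (simp add: algebra_simps power2_eq_square)
    then have "outlier_size u0 u1 u2 \<alpha> \<mu>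
        = (u1 * (1 + \<alpha>\<^sup>2) - \<alpha> * (u0 + u2) - (1 - \<alpha>) * \<mu>) / (1 + \<alpha>\<^sup>2)"
      by (simp only: outlier_size_def)
    then show ?thesis
      unfolding times_divide_eq_left
      by (simp only: diff_divide_distrib nonzero_mult_div_cancel_right[OF nz] times_divide_eq_left)
  qed
  moreover have "((\<lambda>n. outlier_size u0 u1 u2 (a n) (m n)) \<longlongrightarrow> outlier_size u0 u1 u2 \<alpha> \<mu>) F"
    unfolding outlier_size_def using nz by (intro tendsto_intros assms) auto
  ultimately show ?thesis by simp
qed

text \<open>The cost is not convex because of the product \<open>a * t\<close>, but on bounded sets its failure of midpoint
  convexity is controlled by \<open>a\<close> and \<open>m\<close> only, where the main sum of squares is strongly convex.\<close>

lemma outlier_cost_midpoint: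
  obtains C where "C \<ge> 0"
    "\<And>a m t a' m' t'. \<lbrakk>\<bar>a\<bar> \<le> R; \<bar>m\<bar> \<le> R; \<bar>t\<bar> \<le> R; \<bar>a'\<bar> \<le> R; \<bar>m'\<bar> \<le> R; \<bar>t'\<bar> \<le> R\<rbrakk> \<Longrightarrow>
      2 * outlier_cost u0 u1 u2 ((a + a') / 2) ((m + m') / 2) ((t + t') / 2)
      \<le> outlier_cost u0 u1 u2 a m t + outlier_cost u0 u1 u2 a' m' t'
         + C * ((a - a')\<^sup>2 + (m - m')\<^sup>2)"
proof -
  \<comment> \<open>\<open>K\<close> will bound the factor \<open>L\<close>: four residual bounds
    come from \<open>2 * (r + r')\<close>, and the last summand from the product of the half
    differences.\<close>
  define K where "K = 4 * (\<bar>u2\<bar> + \<bar>R\<bar> * \<bar>u1\<bar> + \<bar>R\<bar> + \<bar>R\<bar> * \<bar>R\<bar>) + 2 * \<bar>R\<bar> * \<bar>R\<bar>"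
  have K: "K \<ge> 0" by (simp add: K_def)
  define C where "C = K\<^sup>2 + K * \<bar>u0\<bar> + K"
  have "C \<ge> 0" using K by (simp add: C_def)
  moreover have "2 * outlier_cost u0 u1 u2 ((a + a') / 2) ((m + m') / 2) ((t + t') / 2)
      \<le> outlier_cost u0 u1 u2 a m t + outlier_cost u0 u1 u2 a' m' t'
         + C * ((a - a')\<^sup>2 + (m - m')\<^sup>2)"
    if R: "\<bar>a\<bar> \<le> R" "\<bar>m\<bar> \<le> R" "\<bar>t\<bar> \<le> R" "\<bar>a'\<bar> \<le> R" "\<bar>m'\<bar> \<le> R" "\<bar>t'\<bar> \<le> R" for a m t a' m' t'
  proof -
    define da dm dt where "da = (a - a') / 2" and "dm = (m - m') / 2" and "dt = (t - t') / 2"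
    define r r' where "r = u2 - a * u1 - m + a * t" and "r' = u2 - a' * u1 - m' + a' * t'"
    define v w where "v = u0 * da + dm + dt" and "w = u0 * da + dm"
    define L where "L = 2 * (r + r') - 2 * (da * dt)"
    have R0: "R \<ge> 0" using R(1) by linarith
    \<comment> \<open>The residual at the outlier is affine in all three parameters and contributes
      the convex gain \<open>2 * v\<^sup>2\<close>. The next residual contains \<open>a * t\<close>,
      whose value at the midpoint misses the mean by \<open>da * dt\<close>; this is the only source
      of a term without sign.\<close>
    have id: "outlier_cost u0 u1 u2 a m t + outlier_cost u0 u1 u2 a' m' t'
        - 2 * outlier_cost u0 u1 u2 ((a + a') / 2) ((m + m') / 2) ((t + t') / 2)
        = 2 * v\<^sup>2 + (r - r')\<^sup>2 / 2 + da * dt * L"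
      unfolding outlier_cost_def v_def L_def r_def r'_def da_def dm_def dt_def power2_eq_square
      by (simp add: field_simps)
    have rb: "\<bar>u2 - b * u1 - n + b * s\<bar> \<le> \<bar>u2\<bar> + R * \<bar>u1\<bar> + R + R * R"
      if "\<bar>b\<bar> \<le> R" "\<bar>n\<bar> \<le> R" "\<bar>s\<bar> \<le> R" for b n s
    proof -
      have "\<bar>b * u1\<bar> \<le> R * \<bar>u1\<bar>" "\<bar>b * s\<bar> \<le> R * R"
        using that R0 by (auto simp: abs_mult intro!: mult_mono)
      moreover have "\<bar>u2 - b * u1 - n + b * s\<bar> \<le> \<bar>u2\<bar> + \<bar>b * u1\<bar> + \<bar>n\<bar> + \<bar>b * s\<bar>" by linarith
      ultimately show ?thesis
        using that(2) by (elim order_trans) (intro add_mono order_refl)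
    qed
    have "\<bar>a - a'\<bar> \<le> 2 * R" "\<bar>t - t'\<bar> \<le> 2 * R" using R by linarith+
    then have "\<bar>da\<bar> \<le> R" "\<bar>dt\<bar> \<le> R" by (simp_all add: da_def dt_def)
    then have "\<bar>da * dt\<bar> \<le> R * R" using R0 by (auto simp: abs_mult intro!: mult_mono)
    moreover have "\<bar>r\<bar> \<le> \<bar>u2\<bar> + R * \<bar>u1\<bar> + R + R * R" "\<bar>r'\<bar> \<le> \<bar>u2\<bar> + R * \<bar>u1\<bar> + R + R * R"
      unfolding r_def r'_def using rb R by blast+
    moreover have "K = 4 * (\<bar>u2\<bar> + R * \<bar>u1\<bar> + R + R * R) + 2 * (R * R)"
      using R0 by (simp add: K_def)
    moreover have "\<bar>L\<bar> \<le> 2 * \<bar>r\<bar> + 2 * \<bar>r'\<bar> + 2 * \<bar>da * dt\<bar>"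
    proof -
      have "\<bar>2 * (x1 + x2) - 2 * x3\<bar> \<le> 2 * \<bar>x1\<bar> + 2 * \<bar>x2\<bar> + 2 * \<bar>x3\<bar>" for x1 x2 x3 :: real
        by (simp add: abs_if)
      then show ?thesis unfolding L_def .
    qed
    moreover define B where "B = \<bar>u2\<bar> + R * \<bar>u1\<bar> + R + R * R"
    ultimately have "\<bar>r\<bar> \<le> B" "\<bar>r'\<bar> \<le> B" "\<bar>da * dt\<bar> \<le> R * R" "K = 4 * B + 2 * (R * R)"
        "\<bar>L\<bar> \<le> 2 * \<bar>r\<bar> + 2 * \<bar>r'\<bar> + 2 * \<bar>da * dt\<bar>"
      by (simp_all only: B_def)
    then have L: "\<bar>L\<bar> \<le> K" by argo
    have "\<bar>da * dt * L\<bar> \<le> \<bar>da\<bar> * \<bar>dt\<bar> * K"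
      using L by (simp add: abs_mult mult_left_mono)
    \<comment> \<open>\<open>dt\<close> must not survive, since the final bound involves differences
      of \<open>a\<close> and \<open>m\<close> alone. It is expressed through \<open>v\<close>,
      whose square is available from the affine residual.\<close>
    also have "\<dots> \<le> \<bar>da\<bar> * (\<bar>v\<bar> + \<bar>u0\<bar> * \<bar>da\<bar> + \<bar>dm\<bar>) * K"
    proof -
      have "dt = v - u0 * da - dm" by (simp add: v_def)
      then have "\<bar>dt\<bar> \<le> \<bar>v\<bar> + \<bar>u0\<bar> * \<bar>da\<bar> + \<bar>dm\<bar>" by (simp add: abs_mult[symmetric])
      then show ?thesis using K by (intro mult_right_mono mult_left_mono) auto
    qed
    also have "\<dots> = (K * \<bar>da\<bar>) * \<bar>v\<bar> + K * \<bar>u0\<bar> * da\<^sup>2 + K * (\<bar>da\<bar> * \<bar>dm\<bar>)"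
      by (simp add: algebra_simps power2_eq_square)
    also have "(K * \<bar>da\<bar>) * \<bar>v\<bar> \<le> K\<^sup>2 * da\<^sup>2 + v\<^sup>2"
      using abs_mult_le_sum_squares[of "K * da" v] K by (simp add: abs_mult power_mult_distrib)
    also have "K * (\<bar>da\<bar> * \<bar>dm\<bar>) \<le> K * (da\<^sup>2 + dm\<^sup>2)"
      using abs_mult_le_sum_squares[of da dm] by (intro mult_left_mono K) (simp add: abs_mult)
    finally have "\<bar>da * dt * L\<bar> \<le> K\<^sup>2 * da\<^sup>2 + v\<^sup>2 + K * \<bar>u0\<bar> * da\<^sup>2 + K * (da\<^sup>2 + dm\<^sup>2)" by simp
    also have "\<dots> \<le> C * (da\<^sup>2 + dm\<^sup>2) + v\<^sup>2"
      using K by (simp add: C_def algebra_simps)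
    also have "C * (da\<^sup>2 + dm\<^sup>2) \<le> C * ((a - a')\<^sup>2 + (m - m')\<^sup>2)"
      using \<open>C \<ge> 0\<close> by (intro mult_left_mono add_mono) (auto simp: da_def dm_def power_divide)
    finally have "- (C * ((a - a')\<^sup>2 + (m - m')\<^sup>2)) \<le> 2 * v\<^sup>2 + (r - r')\<^sup>2 / 2 + da * dt * L"
      by (smt (verit) zero_le_power2 divide_nonneg_nonneg)
    then show ?thesis using id by linarith
  qed
  ultimately show thesis by (rule that)
qed

text \<open>Turns bounds on \<open>(a, m)\<close> into bounds on the outlier sizes of a minimizer,
  so that \<open>outlier_cost_midpoint\<close>, which needs all parameters bounded, becomes
  applicable.\<close>

lemma outlier_size_bound:
  assumes "\<bar>a\<bar> \<le> A" "\<bar>m\<bar> \<le> A"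
  shows "\<bar>outlier_size u0 u1 u2 a m\<bar> \<le> \<bar>u1\<bar> + A * \<bar>u0\<bar> + A + A * (\<bar>u2\<bar> + A * \<bar>u1\<bar> + A)"
proof -
  have A: "A \<ge> 0" using assms by linarith
  have b: "\<bar>a * u\<bar> \<le> A * v" if "\<bar>u\<bar> \<le> v" for u v
    using assms that A by (auto simp: abs_mult intro!: mult_mono)
  have 1: "\<bar>u2 - a * u1 - m\<bar> \<le> \<bar>u2\<bar> + A * \<bar>u1\<bar> + A"
    using b[of u1 "\<bar>u1\<bar>"] assms(2) by linarith
  have "\<bar>(u1 - a * u0 - m) - a * (u2 - a * u1 - m)\<bar> \<le> \<bar>u1\<bar> + A * \<bar>u0\<bar> + A + A * (\<bar>u2\<bar> + A * \<bar>u1\<bar> + A)"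
    using b[of u0 "\<bar>u0\<bar>"] b[OF 1] assms(2) by linarith
  moreover have "\<bar>x\<bar> / (1 + a\<^sup>2) \<le> \<bar>x\<bar>" for x :: real
    using mult_left_mono[of 1 "1 + a\<^sup>2" "\<bar>x\<bar>"] by (simp add: field_simps add_pos_nonneg)
  ultimately show ?thesis
    unfolding outlier_size_def abs_divide by (smt (verit) zero_le_power2 abs_of_nonneg)
qed

text \<open>All randomness has been reduced to \<open>gram\<close>, \<open>n1\<close> and
  \<open>n2\<close>. Existence comes from compactness of a sublevel set. Two distinct minimizers
  would be beaten by their midpoint: the main sum gains there a multiple of \<open>n\<close> times
  the squared distance in \<open>(a, m)\<close>, while the outlier terms lose only a fixed multiple
  of it.\<close>

theorem CLSE_consistent:
  fixes y :: "nat \<Rightarrow> real" and \<alpha> \<mu> l :: real and s1 s2 :: nat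
  defines "K \<equiv> \<lambda>n. {1..n} - {s1, s1 + 1, s2, s2 + 1}"
  assumes l: "l > 0"
    and gram: "\<forall>\<^sub>F n in sequentially. \<forall>a b.
           l * real n * (a\<^sup>2 + b\<^sup>2) \<le> (\<Sum>k\<in>K n. (a * y (k - 1) + b)\<^sup>2)"
    and n1: "(\<lambda>n. (\<Sum>k\<in>K n. y k - \<alpha> * y (k - 1) - \<mu>) / real n) \<longlonglongrightarrow> 0"
    and n2: "(\<lambda>n. (\<Sum>k\<in>K n. (y k - \<alpha> * y (k - 1) - \<mu>) * y (k - 1)) / real n) \<longlonglongrightarrow> 0"
  shows CLSE_unique: "\<exists>n0. \<forall>n\<ge>n0. \<exists>!p. \<forall>q. Qn4 s1 s2 n y p \<le> Qn4 s1 s2 n y q"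
    and CLSE_tendsto_alpha: "(\<lambda>n. fst (CLSE s1 s2 n y)) \<longlonglongrightarrow> \<alpha>"
    and CLSE_tendsto_mu: "(\<lambda>n. fst (snd (CLSE s1 s2 n y))) \<longlonglongrightarrow> \<mu>"
    and CLSE_tendsto_theta1: "(\<lambda>n. fst (snd (snd (CLSE s1 s2 n y)))) \<longlonglongrightarrow>
      y s1 - \<alpha> / (1 + \<alpha>\<^sup>2) * (y (s1 - 1) + y (s1 + 1)) - (1 - \<alpha>) / (1 + \<alpha>\<^sup>2) * \<mu>"
    and CLSE_tendsto_theta2: "(\<lambda>n. snd (snd (snd (CLSE s1 s2 n y)))) \<longlonglongrightarrow>
      y s2 - \<alpha> / (1 + \<alpha>\<^sup>2) * (y (s2 - 1) + y (s2 + 1)) - (1 - \<alpha>) / (1 + \<alpha>\<^sup>2) * \<mu>"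
proof -
  define S where "S n a m = (\<Sum>k\<in>K n. (y k - a * y (k - 1) - m)\<^sup>2)" for n a m
  define h where "h s = outlier_cost (y (s - 1)) (y s) (y (s + 1))" for s
  define \<tau> where "\<tau> s = outlier_size (y (s - 1)) (y s) (y (s + 1))" for s
  have Q: "Qn4 s1 s2 n y (a, m, t1, t2) = S n a m + h s1 a m t1 + h s2 a m t2" for n a m t1 t2
    by (simp add: Qn4_def Qn_def S_def K_def h_def outlier_cost_def)
  have h0: "h s a m t \<ge> 0" for s a m t by (simp add: h_def outlier_cost_nonneg)
  have S0: "S n a m \<ge> 0" for n a m by (simp add: S_def sum_nonneg)
  \<comment> \<open>Cost of the outlier terms at the comparison point
    \<open>(\<alpha>, \<mu>, 0, 0)\<close>; it does not depend on \<open>n\<close>, as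
    \<open>least_squares_sublevel\<close> requires.\<close>
  define C where "C = h s1 \<alpha> \<mu> 0 + h s2 \<alpha> \<mu> 0"
  define mn where "mn n p \<longleftrightarrow> (\<forall>q. Qn4 s1 s2 n y p \<le> Qn4 s1 s2 n y q)" for n p
  from least_squares_sublevel[OF l gram[unfolded K_def] n1[unfolded K_def] n2[unfolded K_def], of C]
  obtain \<eta> where \<eta>: "\<eta> \<longlonglongrightarrow> 0" and sub: "\<forall>\<^sub>F n in sequentially.
      \<forall>a m. S n a m \<le> S n \<alpha> \<mu> + C \<longrightarrow> (a - \<alpha>)\<^sup>2 + (m - \<mu>)\<^sup>2 \<le> \<eta> n"
    unfolding S_def K_def by blast
  have mnD: "t1 = \<tau> s1 a m" "t2 = \<tau> s2 a m" "S n a m \<le> S n \<alpha> \<mu> + C"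
    if "mn n (a, m, t1, t2)" for n a m t1 t2
  proof -
    have "Qn4 s1 s2 n y (a, m, t1, t2) \<le> Qn4 s1 s2 n y (a, m, \<tau> s1 a m, t2)"
      using that by (simp add: mn_def)
    then show "t1 = \<tau> s1 a m"
      unfolding \<tau>_def by (intro outlier_cost_le_imp_eq) (simp add: Q h_def \<tau>_def)
    have "Qn4 s1 s2 n y (a, m, t1, t2) \<le> Qn4 s1 s2 n y (a, m, t1, \<tau> s2 a m)"
      using that by (simp add: mn_def)
    then show "t2 = \<tau> s2 a m"
      unfolding \<tau>_def by (intro outlier_cost_le_imp_eq) (simp add: Q h_def \<tau>_def)
    have "Qn4 s1 s2 n y (a, m, t1, t2) \<le> Qn4 s1 s2 n y (\<alpha>, \<mu>, 0, 0)"
      using that by (simp add: mn_def)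
    then show "S n a m \<le> S n \<alpha> \<mu> + C"
      using h0[of s1 a m t1] h0[of s2 a m t2] by (simp add: Q C_def)
  qed
  define A where "A = \<bar>\<alpha>\<bar> + \<bar>\<mu>\<bar> + 1"
  have near: "\<bar>a\<bar> \<le> A" "\<bar>m\<bar> \<le> A" if "(a - \<alpha>)\<^sup>2 + (m - \<mu>)\<^sup>2 \<le> e" "e < 1" for a m e
  proof -
    have "(a - \<alpha>)\<^sup>2 \<le> 1" "(m - \<mu>)\<^sup>2 \<le> 1" using that by (smt (verit) zero_le_power2)+
    then have "\<bar>a - \<alpha>\<bar> \<le> 1" "\<bar>m - \<mu>\<bar> \<le> 1" by (simp_all add: abs_square_le_1)
    then show "\<bar>a\<bar> \<le> A" "\<bar>m\<bar> \<le> A" by (auto simp: A_def)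
  qed
  define bd where "bd s = \<bar>y s\<bar> + A * \<bar>y (s - 1)\<bar> + A + A * (\<bar>y (s + 1)\<bar> + A * \<bar>y s\<bar> + A)" for s
  \<comment> \<open>One radius for all parameters of a minimizer: \<open>A\<close> serves for
    \<open>(a, m)\<close> as soon as \<open>\<eta> n < 1\<close>, and \<open>bd\<close> for the two
    outlier sizes.\<close>
  define R where "R = max A (max (bd s1) (bd s2))"
  have R: "A \<le> R" "bd s1 \<le> R" "bd s2 \<le> R" by (auto simp: R_def)
  have \<tau>b: "\<bar>\<tau> s a m\<bar> \<le> bd s" if "\<bar>a\<bar> \<le> A" "\<bar>m\<bar> \<le> A" for s a m
    unfolding \<tau>_def bd_def by (rule outlier_size_bound[OF that])
  obtain C1 where C1: "C1 \<ge> 0" "\<And>a m t a' m' t'. \<lbrakk>\<bar>a\<bar> \<le> R; \<bar>m\<bar> \<le> R; \<bar>t\<bar> \<le> R; \<bar>a'\<bar> \<le> R; \<bar>m'\<bar> \<le> R; \<bar>t'\<bar> \<le> R\<rbrakk> \<Longrightarrow>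
      2 * h s1 ((a + a') / 2) ((m + m') / 2) ((t + t') / 2)
      \<le> h s1 a m t + h s1 a' m' t' + C1 * ((a - a')\<^sup>2 + (m - m')\<^sup>2)"
    unfolding h_def
    by (rule outlier_cost_midpoint[where R = R and ?u0.0 = "y (s1 - 1)" and ?u1.0 = "y s1" and ?u2.0 = "y (s1 + 1)"]) auto
  obtain C2 where C2: "C2 \<ge> 0" "\<And>a m t a' m' t'. \<lbrakk>\<bar>a\<bar> \<le> R; \<bar>m\<bar> \<le> R; \<bar>t\<bar> \<le> R; \<bar>a'\<bar> \<le> R; \<bar>m'\<bar> \<le> R; \<bar>t'\<bar> \<le> R\<rbrakk> \<Longrightarrow>
      2 * h s2 ((a + a') / 2) ((m + m') / 2) ((t + t') / 2)
      \<le> h s2 a m t + h s2 a' m' t' + C2 * ((a - a')\<^sup>2 + (m - m')\<^sup>2)"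
    unfolding h_def
    by (rule outlier_cost_midpoint[where R = R and ?u0.0 = "y (s2 - 1)" and ?u1.0 = "y s2" and ?u2.0 = "y (s2 + 1)"]) auto
  have \<eta>1: "\<forall>\<^sub>F n in sequentially. \<eta> n < 1" using order_tendstoD(2)[OF \<eta>, of 1] by simp
  have large: "\<forall>\<^sub>F n in sequentially. 2 * (C1 + C2) < l * real n"
  proof -
    have "filterlim (\<lambda>n. l * real n) at_top sequentially" using l by real_asymp
    then show ?thesis by (simp add: filterlim_at_top_dense)
  qed
  have ex1: "\<forall>\<^sub>F n in sequentially. \<exists>!p. mn n p"
    using sub gram \<eta>1 large
  proof eventually_elim
    case (elim n)
    define L where "L = {p. Qn4 s1 s2 n y p \<le> Qn4 s1 s2 n y (\<alpha>, \<mu>, 0, 0)}"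
    have cont: "continuous_on X (Qn4 s1 s2 n y)" for X
    proof -
      have "Qn4 s1 s2 n y = (\<lambda>p. Qn s1 s2 n y (fst p) (fst (snd p)) (fst (snd (snd p))) (snd (snd (snd p))))"
        by (auto simp: Qn4_def fun_eq_iff)
      then show ?thesis unfolding Qn_def by (auto intro!: continuous_intros)
    qed
    have "closed L" unfolding L_def by (intro closed_Collect_le cont continuous_on_const)
    define q0 where "q0 = Qn4 s1 s2 n y (\<alpha>, \<mu>, 0, 0)"
    \<comment> \<open>In the sublevel set the residual at an outlier is at most
      \<open>sqrt q0\<close> in absolute value; solving it for \<open>t\<close> gives this
      bound.\<close>
    define W where "W s = sqrt q0 + \<bar>y s\<bar> + A * \<bar>y (s - 1)\<bar> + A" for s
    have "L \<subseteq> {-A..A} \<times> {-A..A} \<times> {- W s1..W s1} \<times> {- W s2..W s2}"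
    proof
      fix p assume "p \<in> L"
      obtain a m t1 t2 where p: "p = (a, m, t1, t2)" by (cases p) auto
      have le: "S n a m + h s1 a m t1 + h s2 a m t2 \<le> q0" "q0 = S n \<alpha> \<mu> + C"
        using \<open>p \<in> L\<close> by (auto simp: L_def p q0_def Q C_def)
      then have "S n a m \<le> S n \<alpha> \<mu> + C" using h0[of s1 a m t1] h0[of s2 a m t2] by linarith
      then have am: "\<bar>a\<bar> \<le> A" "\<bar>m\<bar> \<le> A" using near[OF _ elim(3)] elim(1) by blast+
      have t: "\<bar>t\<bar> \<le> W s" if "h s a m t \<le> q0" for s t
      proof -
        have "(y s - a * y (s - 1) - m - t)\<^sup>2 \<le> q0"
          using that zero_le_power2[of "y (s + 1) - a * y s - m + a * t"]
          unfolding h_def outlier_cost_def by linarith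
        then have "\<bar>y s - a * y (s - 1) - m - t\<bar> \<le> sqrt q0"
          by (metis real_sqrt_abs real_sqrt_le_iff)
        moreover have "\<bar>a * y (s - 1)\<bar> \<le> A * \<bar>y (s - 1)\<bar>"
          using am by (simp add: abs_mult mult_right_mono)
        moreover have "\<bar>t\<bar> \<le> \<bar>y s - a * y (s - 1) - m - t\<bar> + \<bar>y s\<bar> + \<bar>a * y (s - 1)\<bar> + \<bar>m\<bar>"
          by linarith
        ultimately show ?thesis
          unfolding W_def using am(2) by (elim order_trans) (intro add_mono order_refl)
      qed
      have "\<bar>t1\<bar> \<le> W s1" "\<bar>t2\<bar> \<le> W s2"
        using le S0[of n a m] h0[of s1 a m t1] h0[of s2 a m t2] by (intro t; linarith)+
      with am show "p \<in> {-A..A} \<times> {-A..A} \<times> {- W s1..W s1} \<times> {- W s2..W s2}"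
        by (auto simp: p)
    qed
    moreover have "compact ({-A..A} \<times> {-A..A} \<times> {- W s1..W s1} \<times> {- W s2..W s2})"
      by (intro compact_Times compact_Icc)
    ultimately have "compact L"
      using \<open>closed L\<close> by (metis compact_Int_closed inf.absorb_iff2)
    moreover have "L \<noteq> {}" by (auto simp: L_def)
    ultimately have "\<exists>p\<in>L. \<forall>q\<in>L. Qn4 s1 s2 n y p \<le> Qn4 s1 s2 n y q"
      by (rule continuous_attains_inf[OF _ _ cont])
    then obtain p where p: "p \<in> L" "\<And>q. q \<in> L \<Longrightarrow> Qn4 s1 s2 n y p \<le> Qn4 s1 s2 n y q"
      by blast
    have "mn n p"
      unfolding mn_def
    proof
      fix q show "Qn4 s1 s2 n y p \<le> Qn4 s1 s2 n y q"
        using p(1) p(2)[of q] unfolding L_def mem_Collect_eq by linarith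
    qed
    moreover have "p = q" if mp: "mn n p" and mq: "mn n q" for p q
    proof -
      obtain a m t1 t2 where p: "p = (a, m, t1, t2)" by (cases p) auto
      obtain a' m' t1' t2' where q: "q = (a', m', t1', t2')" by (cases q) auto
      note P = mnD[OF mp[unfolded p]] and P' = mnD[OF mq[unfolded q]]
      have am: "\<bar>a\<bar> \<le> A" "\<bar>m\<bar> \<le> A" using near[OF _ elim(3)] elim(1) P(3) by blast+
      have am': "\<bar>a'\<bar> \<le> A" "\<bar>m'\<bar> \<le> A" using near[OF _ elim(3)] elim(1) P'(3) by blast+
      have bds: "\<bar>a\<bar> \<le> R" "\<bar>m\<bar> \<le> R" "\<bar>t1\<bar> \<le> R" "\<bar>t2\<bar> \<le> R"
          "\<bar>a'\<bar> \<le> R" "\<bar>m'\<bar> \<le> R" "\<bar>t1'\<bar> \<le> R" "\<bar>t2'\<bar> \<le> R"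
        unfolding P(1,2) P'(1,2)
        by (rule order_trans[OF am(1) R(1)] order_trans[OF am(2) R(1)] order_trans[OF am'(1) R(1)]
            order_trans[OF am'(2) R(1)] order_trans[OF \<tau>b[OF am] R(2)] order_trans[OF \<tau>b[OF am] R(3)]
            order_trans[OF \<tau>b[OF am'] R(2)] order_trans[OF \<tau>b[OF am'] R(3)])+
      define D where "D = (a - a')\<^sup>2 + (m - m')\<^sup>2"
      have "S n a m + S n a' m' - 2 * S n ((a + a') / 2) ((m + m') / 2)
          = (\<Sum>k\<in>K n. ((a - a') * y (k - 1) + (m - m'))\<^sup>2) / 2"
        unfolding S_def sum_distrib_left sum_divide_distrib sum.distrib[symmetric] sum_subtractf[symmetric]
        by (intro sum.cong refl) (simp add: power2_eq_square field_simps)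
      moreover have "l * real n * D \<le> (\<Sum>k\<in>K n. ((a - a') * y (k - 1) + (m - m'))\<^sup>2)"
        unfolding D_def using elim(2) by blast
      ultimately have Sm: "2 * S n ((a + a') / 2) ((m + m') / 2) \<le> S n a m + S n a' m' - l * real n * D / 2"
        by linarith
      \<comment> \<open>Minimality at \<open>p\<close> and \<open>q\<close> forces the last term to
        be nonnegative, whereas its factor is negative for large \<open>n\<close>. Hence
        \<open>D = 0\<close>, and the outlier sizes agree because they are functions of
        \<open>(a, m)\<close>.\<close>
      have "2 * Qn4 s1 s2 n y ((a + a') / 2, (m + m') / 2, (t1 + t1') / 2, (t2 + t2') / 2)
          \<le> Qn4 s1 s2 n y p + Qn4 s1 s2 n y q + (C1 + C2 - l * real n / 2) * D"
        using Sm C1(2)[OF bds(1,2,3,5,6,7)] C2(2)[OF bds(1,2,4,5,6,8)]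
        unfolding p q Q D_def[symmetric] by (simp add: algebra_simps)
      moreover have "Qn4 s1 s2 n y p \<le> Qn4 s1 s2 n y ((a + a') / 2, (m + m') / 2, (t1 + t1') / 2, (t2 + t2') / 2)"
        "Qn4 s1 s2 n y q \<le> Qn4 s1 s2 n y ((a + a') / 2, (m + m') / 2, (t1 + t1') / 2, (t2 + t2') / 2)"
        using mp mq by (auto simp: mn_def)
      ultimately have "0 \<le> (C1 + C2 - l * real n / 2) * D" by linarith
      moreover have "C1 + C2 - l * real n / 2 < 0" using elim(4) by simp
      ultimately have "D \<le> 0" by (simp add: zero_le_mult_iff)
      then have "a = a'" "m = m'" unfolding D_def by (simp_all add: sum_power2_le_zero_iff)
      then show "p = q" using P P' by (simp add: p q)
    qed
    ultimately show ?case by blast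
  qed
  then show "\<exists>n0. \<forall>n\<ge>n0. \<exists>!p. \<forall>q. Qn4 s1 s2 n y p \<le> Qn4 s1 s2 n y q"
    unfolding mn_def eventually_sequentially .
  define ah mh where "ah n = fst (CLSE s1 s2 n y)" and "mh n = fst (snd (CLSE s1 s2 n y))" for n
  \<comment> \<open>\<open>CLSE\<close> is a definite description and is known to be a minimizer
    only where that minimizer is unique. Its properties thus hold eventually, which is enough for
    limits.\<close>
  have min: "\<forall>\<^sub>F n in sequentially. mn n (CLSE s1 s2 n y)"
    using ex1 by eventually_elim (unfold CLSE_def mn_def, rule theI')
  have close: "\<forall>\<^sub>F n in sequentially. (ah n - \<alpha>)\<^sup>2 + (mh n - \<mu>)\<^sup>2 \<le> \<eta> n"
    using min sub
  proof eventually_elim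
    case (elim n)
    then show ?case
      using mnD(3)[of n "ah n" "mh n" "fst (snd (snd (CLSE s1 s2 n y)))" "snd (snd (snd (CLSE s1 s2 n y)))"]
      by (simp add: ah_def mh_def)
  qed
  have sq: "f \<longlonglongrightarrow> c" if "\<forall>\<^sub>F n in sequentially. (f n - c)\<^sup>2 \<le> \<eta> n" for f and c :: real
  proof -
    have "(\<lambda>n. (f n - c)\<^sup>2) \<longlonglongrightarrow> 0"
      using that by (intro tendsto_sandwich[OF _ _ tendsto_const \<eta>]) auto
    then have "(\<lambda>n. sqrt ((f n - c)\<^sup>2)) \<longlonglongrightarrow> sqrt 0" by (rule tendsto_real_sqrt)
    then show ?thesis by (simp add: tendsto_rabs_zero_iff LIM_zero_iff)
  qed
  have ah: "ah \<longlonglongrightarrow> \<alpha>"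
    by (rule sq) (use close in \<open>auto elim!: eventually_mono intro: order_trans[rotated]\<close>)
  have mh: "mh \<longlonglongrightarrow> \<mu>"
    by (rule sq) (use close in \<open>auto elim!: eventually_mono intro: order_trans[rotated]\<close>)
  show "(\<lambda>n. fst (CLSE s1 s2 n y)) \<longlonglongrightarrow> \<alpha>" "(\<lambda>n. fst (snd (CLSE s1 s2 n y))) \<longlonglongrightarrow> \<mu>"
    using ah mh by (simp_all add: ah_def[abs_def] mh_def[abs_def])
  have \<tau>lim: "(\<lambda>n. \<tau> s (ah n) (mh n)) \<longlonglongrightarrow>
      y s - \<alpha> / (1 + \<alpha>\<^sup>2) * (y (s - 1) + y (s + 1)) - (1 - \<alpha>) / (1 + \<alpha>\<^sup>2) * \<mu>" for s
    unfolding \<tau>_def by (rule tendsto_outlier_size[OF ah mh])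
  have ev: "\<forall>\<^sub>F n in sequentially. fst (snd (snd (CLSE s1 s2 n y))) = \<tau> s1 (ah n) (mh n) \<and>
      snd (snd (snd (CLSE s1 s2 n y))) = \<tau> s2 (ah n) (mh n)"
    using min
  proof eventually_elim
    case (elim n)
    then have m: "mn n (ah n, mh n, fst (snd (snd (CLSE s1 s2 n y))), snd (snd (snd (CLSE s1 s2 n y))))"
      by (simp add: ah_def mh_def)
    show ?case using mnD(1)[OF m] mnD(2)[OF m] by blast
  qed
  show "(\<lambda>n. fst (snd (snd (CLSE s1 s2 n y)))) \<longlonglongrightarrow>
      y s1 - \<alpha> / (1 + \<alpha>\<^sup>2) * (y (s1 - 1) + y (s1 + 1)) - (1 - \<alpha>) / (1 + \<alpha>\<^sup>2) * \<mu>"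
    using ev by (intro Lim_transform_eventually[OF \<tau>lim]) (auto elim: eventually_mono)
  show "(\<lambda>n. snd (snd (snd (CLSE s1 s2 n y)))) \<longlonglongrightarrow>
      y s2 - \<alpha> / (1 + \<alpha>\<^sup>2) * (y (s2 - 1) + y (s2 + 1)) - (1 - \<alpha>) / (1 + \<alpha>\<^sup>2) * \<mu>"
    using ev by (intro Lim_transform_eventually[OF \<tau>lim]) (auto elim: eventually_mono)
qed

section \<open>A strong law for martingale differences\<close>

lemma square_integrable_mult:
  fixes f g :: "'a \<Rightarrow> real"
  assumes [measurable]: "f \<in> borel_measurable M" "g \<in> borel_measurable M"
    and f: "integrable M (\<lambda>x. (f x)\<^sup>2)" and g: "integrable M (\<lambda>x. (g x)\<^sup>2)"
  shows "integrable M (\<lambda>x. f x * g x)"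
proof (rule Bochner_Integration.integrable_bound)
  show "integrable M (\<lambda>x. (f x)\<^sup>2 + (g x)\<^sup>2)" using f g by simp
  show "AE x in M. norm (f x * g x) \<le> norm ((f x)\<^sup>2 + (g x)\<^sup>2)"
    using abs_mult_le_sum_squares by (intro AE_I2) simp
qed simp

lemma square_integrable_add:
  fixes f g :: "'a \<Rightarrow> real"
  assumes [measurable]: "f \<in> borel_measurable M" "g \<in> borel_measurable M"
    and f: "integrable M (\<lambda>x. (f x)\<^sup>2)" and g: "integrable M (\<lambda>x. (g x)\<^sup>2)"
  shows "integrable M (\<lambda>x. (f x + g x)\<^sup>2)"
  using f g square_integrable_mult[OF assms]
  by (simp add: power2_sum mult.assoc)

lemma square_integrable_bounded_mult:
  fixes f g :: "'a \<Rightarrow> real"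
  assumes [measurable]: "f \<in> borel_measurable M" "g \<in> borel_measurable M"
    and g: "integrable M (\<lambda>x. (g x)\<^sup>2)" and b: "\<And>x. \<bar>f x\<bar> \<le> B"
  shows "integrable M (\<lambda>x. (f x * g x)\<^sup>2)"
proof (rule Bochner_Integration.integrable_bound)
  show "integrable M (\<lambda>x. B\<^sup>2 * (g x)\<^sup>2)" using g by simp
  show "AE x in M. norm ((f x * g x)\<^sup>2) \<le> norm (B\<^sup>2 * (g x)\<^sup>2)"
  proof (rule AE_I2)
    fix x have "(f x)\<^sup>2 \<le> B\<^sup>2" using b[of x] by (simp add: abs_le_square_iff[symmetric])
    then show "norm ((f x * g x)\<^sup>2) \<le> norm (B\<^sup>2 * (g x)\<^sup>2)"
      by (simp add: power_mult_distrib mult_right_mono)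
  qed
qed simp

text \<open>\<open>D_orth\<close> expresses that \<open>D n\<close> has conditional expectation 0
  given \<open>F n\<close>, tested against square integrable functions. This form follows directly
  from product formulas for independent variables and is what the variance computation
  consumes.\<close>

locale mart_diff = prob_space M for M :: "'a measure" +
  fixes F :: "nat \<Rightarrow> 'a measure" and D :: "nat \<Rightarrow> 'a \<Rightarrow> real"
  assumes sub: "subalgebra M (F n)"
    and mono: "sets (F n) \<subseteq> sets (F (Suc n))"
    and D_meas: "D n \<in> borel_measurable (F (Suc n))"
    and D_sq: "integrable M (\<lambda>\<omega>. (D n \<omega>)\<^sup>2)"
    and D_orth: "\<lbrakk>f \<in> borel_measurable (F n); integrable M (\<lambda>\<omega>. (f \<omega>)\<^sup>2)\<rbrakk>
       \<Longrightarrow> (\<integral>\<omega>. D n \<omega> * f \<omega> \<partial>M) = 0"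
begin

lemma space_F [simp]: "space (F n) = space M"
  using sub by (simp add: subalgebra_def)

lemma measurable_F_mono: "m \<le> n \<Longrightarrow> f \<in> measurable (F m) N \<Longrightarrow> f \<in> measurable (F n) N"
proof -
  assume "m \<le> n" and f: "f \<in> measurable (F m) N"
  from \<open>m \<le> n\<close> have "sets (F m) \<subseteq> sets (F n)"
    by (induction rule: dec_induct) (use mono in blast)+
  with f show ?thesis by (auto simp: measurable_def)
qed

lemma measurable_F_M: "f \<in> measurable (F m) N \<Longrightarrow> f \<in> measurable M N"
  by (rule measurable_from_subalg[OF sub])

definition S :: "nat \<Rightarrow> 'a \<Rightarrow> real" where
  "S n \<omega> = (\<Sum>k<n. D k \<omega>)"

lemma S_meas: "S n \<in> borel_measurable (F n)"
  unfolding S_def[abs_def]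
  by (rule borel_measurable_sum) (rule measurable_F_mono[OF _ D_meas], auto)

text \<open>Freezing the partial sums once they leave \<open>(- c, c)\<close> preserves orthogonality and reduces the
  maximal inequality to Chebyshev's inequality for the frozen sum.\<close>

definition alive :: "real \<Rightarrow> nat \<Rightarrow> 'a \<Rightarrow> real" where
  "alive c n \<omega> = of_bool (\<forall>i\<le>n. \<bar>S i \<omega>\<bar> < c)"

lemma alive_meas: "alive c n \<in> borel_measurable (F n)"
proof -
  have [measurable]: "S i \<in> borel_measurable (F n)" if "i \<in> {..n}" for i
    using that by (intro measurable_F_mono[OF _ S_meas]) auto
  have "Measurable.pred (F n) (\<lambda>\<omega>. \<forall>i\<in>{..n}. \<bar>S i \<omega>\<bar> < c)"
    by measurable
  then show ?thesis
    unfolding alive_def[abs_def] of_bool_def atMost_iff Ball_def by measurable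
qed

definition stopped :: "real \<Rightarrow> nat \<Rightarrow> 'a \<Rightarrow> real" where
  "stopped c n \<omega> = (\<Sum>k<n. alive c k \<omega> * D k \<omega>)"

lemma stopped_meas: "stopped c n \<in> borel_measurable (F n)"
  unfolding stopped_def[abs_def]
  by (intro borel_measurable_sum borel_measurable_times
       measurable_F_mono[OF _ D_meas] measurable_F_mono[OF _ alive_meas]) auto

text \<open>\<open>alive c n * stopped c n\<close> is known at time \<open>n\<close>, so the cross
  term is orthogonal to \<open>D n\<close> and the second moments of the increments add; the factor
  \<open>alive\<close> can only lower them.\<close>

lemma stopped_square:
  "integrable M (\<lambda>\<omega>. (stopped c n \<omega>)\<^sup>2) \<and>
   (\<integral>\<omega>. (stopped c n \<omega>)\<^sup>2 \<partial>M) \<le> (\<Sum>k<n. \<integral>\<omega>. (D k \<omega>)\<^sup>2 \<partial>M)"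
proof (induction n)
  case 0
  then show ?case by (simp add: stopped_def)
next
  case (Suc n)
  have aF [measurable]: "alive c n \<in> borel_measurable M" "D n \<in> borel_measurable M" "stopped c n \<in> borel_measurable M"
    using measurable_F_M alive_meas D_meas stopped_meas by blast+
  have ab: "\<bar>alive c n \<omega>\<bar> \<le> 1" for \<omega> by (simp add: alive_def)
  have i1: "integrable M (\<lambda>\<omega>. (alive c n \<omega> * D n \<omega>)\<^sup>2)"
    by (rule square_integrable_bounded_mult[OF _ _ D_sq ab]) measurable
  have i2: "integrable M (\<lambda>\<omega>. (stopped c n \<omega>)\<^sup>2)" using Suc by simp
  have i3: "integrable M (\<lambda>\<omega>. (alive c n \<omega> * stopped c n \<omega>)\<^sup>2)"
    by (rule square_integrable_bounded_mult[OF _ _ i2 ab]) measurable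
  have i4: "integrable M (\<lambda>\<omega>. D n \<omega> * (alive c n \<omega> * stopped c n \<omega>))"
    by (rule square_integrable_mult[OF _ _ D_sq i3]) measurable
  have z: "(\<integral>\<omega>. D n \<omega> * (alive c n \<omega> * stopped c n \<omega>) \<partial>M) = 0"
    by (intro D_orth i3 borel_measurable_times alive_meas stopped_meas)
  have eq: "(stopped c (Suc n) \<omega>)\<^sup>2 = (stopped c n \<omega>)\<^sup>2
      + 2 * (D n \<omega> * (alive c n \<omega> * stopped c n \<omega>)) + (alive c n \<omega> * D n \<omega>)\<^sup>2" for \<omega>
    by (simp add: stopped_def power2_eq_square algebra_simps)
  have "(\<integral>\<omega>. (stopped c (Suc n) \<omega>)\<^sup>2 \<partial>M)
      = (\<integral>\<omega>. (stopped c n \<omega>)\<^sup>2 \<partial>M) + (\<integral>\<omega>. (alive c n \<omega> * D n \<omega>)\<^sup>2 \<partial>M)"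
    unfolding eq using i1 i2 i4 z by simp
  also have "(\<integral>\<omega>. (alive c n \<omega> * D n \<omega>)\<^sup>2 \<partial>M) \<le> (\<integral>\<omega>. (D n \<omega>)\<^sup>2 \<partial>M)"
    by (rule integral_mono[OF i1 D_sq]) (simp add: alive_def)
  finally have "(\<integral>\<omega>. (stopped c (Suc n) \<omega>)\<^sup>2 \<partial>M) \<le> (\<Sum>k<Suc n. \<integral>\<omega>. (D k \<omega>)\<^sup>2 \<partial>M)"
    using Suc by simp
  moreover have "integrable M (\<lambda>\<omega>. (stopped c (Suc n) \<omega>)\<^sup>2)"
    unfolding eq using i1 i2 i4 by simp
  ultimately show ?case by simp
qed

lemma stopped_eq:
  "(if \<forall>i\<le>n. \<bar>S i \<omega>\<bar> < c then stopped c n \<omega> = S n \<omega> else c \<le> \<bar>stopped c n \<omega>\<bar>)"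
proof (induction n)
  case 0
  then show ?case by (simp add: stopped_def S_def)
next
  case (Suc n)
  show ?case
  proof (cases "\<forall>i\<le>n. \<bar>S i \<omega>\<bar> < c")
    case True
    then have "stopped c (Suc n) \<omega> = S (Suc n) \<omega>"
      using Suc by (simp add: stopped_def S_def alive_def)
    with True show ?thesis by (auto simp: le_Suc_eq)
  next
    case False
    then have "stopped c (Suc n) \<omega> = stopped c n \<omega>"
      by (simp add: stopped_def alive_def)
    with False Suc show ?thesis by (auto simp: le_Suc_eq)
  qed
qed

lemma maximal_inequality:
  assumes "c > 0"
  shows "prob {\<omega>\<in>space M. \<exists>i\<le>n. c \<le> \<bar>S i \<omega>\<bar>} \<le> (\<Sum>k<n. \<integral>\<omega>. (D k \<omega>)\<^sup>2 \<partial>M) / c\<^sup>2"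
proof -
  have [measurable]: "stopped c n \<in> borel_measurable M"
    by (rule measurable_F_M[OF stopped_meas])
  have "prob {\<omega>\<in>space M. \<exists>i\<le>n. c \<le> \<bar>S i \<omega>\<bar>} \<le> prob {\<omega>\<in>space M. c \<le> \<bar>stopped c n \<omega>\<bar>}"
  proof (rule finite_measure_mono)
    show "{\<omega>\<in>space M. \<exists>i\<le>n. c \<le> \<bar>S i \<omega>\<bar>} \<subseteq> {\<omega>\<in>space M. c \<le> \<bar>stopped c n \<omega>\<bar>}"
      using stopped_eq[of n _ c] by (auto simp: not_less split: if_splits) (meson leD)+
  qed measurable
  also have "\<dots> \<le> (\<integral>\<omega>. (stopped c n \<omega>)\<^sup>2 \<partial>M) / c\<^sup>2"
    using stopped_square[of c n] assms by (intro second_moment_method) auto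
  also have "\<dots> \<le> (\<Sum>k<n. \<integral>\<omega>. (D k \<omega>)\<^sup>2 \<partial>M) / c\<^sup>2"
    using stopped_square[of c n] by (intro divide_right_mono) auto
  finally show ?thesis .
qed

text \<open>The growth hypothesis says that the variance of \<open>S n\<close> is of order at most \<open>n powr (7/4)\<close>
  along \<open>n = 16 ^ j\<close>.\<close>
theorem strong_law:
  assumes var: "\<And>j. (\<Sum>k<16 ^ j. \<integral>\<omega>. (D k \<omega>)\<^sup>2 \<partial>M) \<le> C * 128 ^ j"
  shows "AE \<omega> in M. (\<lambda>n. (\<Sum>k<n. D k \<omega>) / real n) \<longlonglongrightarrow> 0"
proof -
  have [measurable]: "S i \<in> borel_measurable M" for i
    by (rule measurable_F_M[OF S_meas])
  \<comment> \<open>The maximum up to \<open>16 ^ Suc j\<close> is compared with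
    \<open>16 ^ j\<close>, so every index between these two powers is covered by the estimate for
    block \<open>j\<close>.\<close>
  have ae: "AE \<omega> in M. \<forall>\<^sub>F j in sequentially. \<forall>i\<le>16 ^ Suc j. \<bar>S i \<omega>\<bar> < e * 16 ^ j" if "e > 0" for e
  proof -
    define A where "A j = {\<omega>\<in>space M. \<exists>i\<le>16 ^ Suc j. e * 16 ^ j \<le> \<bar>S i \<omega>\<bar>}" for j :: nat
    have A: "A j \<in> events" for j
    proof -
      have "A j = {\<omega>\<in>space M. \<exists>i\<in>{..16 ^ Suc j}. e * 16 ^ j \<le> \<bar>S i \<omega>\<bar>}" by (auto simp: A_def)
      also have "\<dots> \<in> events" by measurable
      finally show ?thesis .
    qed
    \<comment> \<open>The maximal inequality divides \<open>128 ^ Suc j\<close> by a multiple of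
      \<open>(16 ^ j)\<^sup>2 = 256 ^ j\<close>; the resulting ratio 1/2 makes the probabilities
      summable.\<close>
    have pA: "prob (A j) \<le> 128 * C / e\<^sup>2 * (1 / 2) ^ j" for j
    proof -
      have "prob (A j) \<le> (\<Sum>k<16 ^ Suc j. \<integral>\<omega>. (D k \<omega>)\<^sup>2 \<partial>M) / (e * 16 ^ j)\<^sup>2"
        unfolding A_def by (rule maximal_inequality) (use that in simp)
      also have "\<dots> \<le> C * 128 ^ Suc j / (e * 16 ^ j)\<^sup>2"
        by (rule divide_right_mono[OF var]) simp
      also have "(e * 16 ^ j)\<^sup>2 = e\<^sup>2 * (128 ^ j * 2 ^ j)"
        by (simp add: power_mult_distrib power2_eq_square flip: power_mult_distrib)
      finally show ?thesis using that by (simp add: field_simps)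
    qed
    have "summable (\<lambda>j. 128 * C / e\<^sup>2 * (1 / 2) ^ j)"
      by (rule summable_mult, rule summable_geometric) simp
    then have "summable (\<lambda>j. prob (A j))"
      by (rule summable_comparison_test'[where N = 0]) (simp only: real_norm_def abs_of_nonneg[OF measure_nonneg] pA)
    then have "AE \<omega> in M. \<forall>\<^sub>F j in sequentially. \<omega> \<in> space M - A j"
      by (intro borel_cantelli_AE1 A) (auto simp: emeasure_eq_measure)
    then show ?thesis
    proof (rule AE_mp, intro AE_I2 impI)
      fix \<omega> assume "\<forall>\<^sub>F j in sequentially. \<omega> \<in> space M - A j"
      then show "\<forall>\<^sub>F j in sequentially. \<forall>i\<le>16 ^ Suc j. \<bar>S i \<omega>\<bar> < e * 16 ^ j"
        by eventually_elim (unfold A_def, use not_le in blast)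
    qed
  qed
  \<comment> \<open>Countably many levels \<open>1 / real (Suc r)\<close> stand in for all positive
    \<open>e\<close>, which keeps a single null set.\<close>
  have "AE \<omega> in M. \<forall>r::nat. \<forall>\<^sub>F j in sequentially. \<forall>i\<le>16 ^ Suc j. \<bar>S i \<omega>\<bar> < 1 / real (Suc r) * 16 ^ j"
    by (subst AE_all_countable) (intro allI ae, simp)
  then show ?thesis
  proof (rule AE_mp, intro AE_I2 impI)
    fix \<omega> assume *: "\<forall>r::nat. \<forall>\<^sub>F j in sequentially. \<forall>i\<le>16 ^ Suc j. \<bar>S i \<omega>\<bar> < 1 / real (Suc r) * 16 ^ j"
    show "(\<lambda>n. (\<Sum>k<n. D k \<omega>) / real n) \<longlonglongrightarrow> 0"
    proof (rule LIMSEQ_I)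
      fix e :: real assume "e > 0"
      then obtain r where r: "1 / real (Suc r) < e"
        using reals_Archimedean by (auto simp: inverse_eq_divide)
      obtain J where J: "\<And>j i. J \<le> j \<Longrightarrow> i \<le> 16 ^ Suc j \<Longrightarrow> \<bar>S i \<omega>\<bar> < 1 / real (Suc r) * 16 ^ j"
        using *[rule_format, of r] unfolding eventually_sequentially by blast
      have "norm ((\<Sum>k<n. D k \<omega>) / real n - 0) < e" if n: "16 ^ J \<le> n" for n
      proof -
        have "\<exists>j\<ge>J. 16 ^ j \<le> n \<and> n < 16 ^ Suc j"
        proof -
          have "n \<ge> 1" using n by (metis one_le_numeral one_le_power order_trans)
          define j where "j = (GREATEST j. (16::nat) ^ j \<le> n)"
          have bnd: "\<forall>j. (16::nat) ^ j \<le> n \<longrightarrow> j \<le> n"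
            using power_gt_expt[of 16] by (auto intro: less_imp_le order_trans)
          have "16 ^ j \<le> n" unfolding j_def by (rule GreatestI_nat[of _ J n]) (use n bnd in auto)
          moreover have "J \<le> j" unfolding j_def by (rule Greatest_le_nat[of _ J n]) (use n bnd in auto)
          moreover have "n < 16 ^ Suc j"
          proof (rule ccontr)
            assume "\<not> n < 16 ^ Suc j"
            then have "Suc j \<le> j" unfolding j_def by (intro Greatest_le_nat[of _ _ n]) (use bnd in auto)
            then show False by simp
          qed
          ultimately show ?thesis by blast
        qed
        then obtain j where j: "J \<le> j" "16 ^ j \<le> n" "n < 16 ^ Suc j" by blast
        have "\<bar>S n \<omega>\<bar> < 1 / real (Suc r) * 16 ^ j" using J[OF j(1)] j(3) by simp
        also have "\<dots> \<le> 1 / real (Suc r) * real n"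
        proof (rule mult_left_mono)
          have "real (16 ^ j) \<le> real n" using j(2) by (rule of_nat_mono)
          then show "16 ^ j \<le> real n" by simp
        qed simp
        finally have "\<bar>S n \<omega>\<bar> < 1 / real (Suc r) * real n" .
        moreover have "real n > 0" using j(2) by (metis gr0I le_zero_eq of_nat_0_less_iff power_eq_0_iff zero_neq_numeral)
        ultimately have "\<bar>S n \<omega>\<bar> / real n < 1 / real (Suc r)" by (simp add: divide_less_eq)
        with r show ?thesis by (simp add: S_def)
      qed
      then show "\<exists>no. \<forall>n\<ge>no. norm ((\<Sum>k<n. D k \<omega>) / real n - 0) < e" by blast
    qed
  qed
qed

end

section \<open>Noise and moments of the INAR(1) process\<close>

lemma measurable_count_space_nat_iff:
  "f \<in> measurable M (count_space UNIV) \<longleftrightarrow> f \<in> borel_measurable M" for f :: "'a \<Rightarrow> nat"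
proof -
  have "measurable M (count_space (UNIV :: nat set)) = borel_measurable M"
    by (rule measurable_cong_sets) (simp_all add: sets_borel_eq_count_space)
  then show ?thesis by simp
qed

text \<open>Serves to remove a truncation: with monotone convergence, a uniform bound on the
  truncated integrals already yields integrability of the limit.\<close>

lemma integrable_bounded_increasing:
  fixes f :: "nat \<Rightarrow> 'a \<Rightarrow> real"
  assumes f: "\<And>i. integrable M (f i)" and mono: "\<And>x. x \<in> space M \<Longrightarrow> mono (\<lambda>n. f n x)"
    and lim: "\<And>x. x \<in> space M \<Longrightarrow> (\<lambda>i. f i x) \<longlonglongrightarrow> u x"
    and u: "u \<in> borel_measurable M" and B: "\<And>i. integral\<^sup>L M (f i) \<le> B"
  shows "integrable M u" "integral\<^sup>L M u \<le> B"
proof -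
  have "incseq (\<lambda>i. integral\<^sup>L M (f i))"
    using f mono by (auto simp: incseq_def mono_def intro!: integral_mono)
  then obtain c where c: "(\<lambda>i. integral\<^sup>L M (f i)) \<longlonglongrightarrow> c" "c \<le> B"
    using incseq_convergent[of _ B] B LIMSEQ_le_const2 by metis
  show "integrable M u"
    by (rule integrable_monotone_convergence[OF f _ _ c(1) u]) (use mono lim in auto)
  have "integral\<^sup>L M u = c"
    by (rule integral_monotone_convergence[OF f _ _ c(1) u]) (use mono lim in auto)
  with c show "integral\<^sup>L M u \<le> B" by simp
qed

section \<open>Independence through generated sigma-algebras\<close>

context prob_space
begin

text \<open>The index set \<open>J\<close> records which primitive variables a function may depend
  on; independence from a further variable then reduces to its index lying outside
  \<open>J\<close>.\<close>

definition gen :: "('i \<Rightarrow> 'a \<Rightarrow> nat) \<Rightarrow> 'i set \<Rightarrow> 'a measure" where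
  "gen X J = sigma (space M) (\<Union>i\<in>J. {X i -` A \<inter> space M | A. A \<in> UNIV})"

lemma space_gen [simp]: "space (gen X J) = space M"
  unfolding gen_def by (rule space_measure_of) auto

lemma sets_gen: "sets (gen X J) = sigma_sets (space M) (\<Union>i\<in>J. {X i -` A \<inter> space M | A. A \<in> UNIV})"
  unfolding gen_def by (rule sets_measure_of) auto

lemma sets_gen_mono: "J \<subseteq> J' \<Longrightarrow> sets (gen X J) \<subseteq> sets (gen X J')"
  unfolding sets_gen by (rule sigma_sets_mono') blast

lemma measurable_gen_mono: "J \<subseteq> J' \<Longrightarrow> f \<in> measurable (gen X J) N \<Longrightarrow> f \<in> measurable (gen X J') N"
  using sets_gen_mono[of J J' X] by (auto simp: measurable_def)

lemma measurable_gen_component: "i \<in> J \<Longrightarrow> X i \<in> measurable (gen X J) (count_space UNIV)"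
  by (rule measurableI) (auto simp: sets_gen intro!: sigma_sets.Basic)

lemma subalgebra_gen:
  assumes "\<And>i. i \<in> J \<Longrightarrow> X i \<in> measurable M (count_space UNIV)"
  shows "subalgebra M (gen X J)"
  unfolding subalgebra_def sets_gen
  by (intro conjI space_gen sets.sigma_sets_subset) (use assms in \<open>auto intro: measurable_sets\<close>)

text \<open>The indices form the disjoint blocks \<open>{i}\<close> and \<open>J\<close>, encoded by
  \<open>bool\<close>. The generators are stable under intersection, so independence passes from the
  family to the sigma-algebras of the blocks.\<close>

lemma indep_var_gen:
  fixes X :: "'i \<Rightarrow> 'a \<Rightarrow> nat" and g :: "nat \<Rightarrow> real"
  assumes X: "indep_vars (\<lambda>_. count_space UNIV) X I" and J: "J \<subseteq> I" "i \<in> I" "i \<notin> J"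
    and f: "f \<in> borel_measurable (gen X J)"
  shows "indep_var borel (\<lambda>\<omega>. g (X i \<omega>)) borel f"
proof -
  let ?E = "\<lambda>i. {X i -` A \<inter> space M | A. A \<in> UNIV}"
  have rv: "\<And>i. i \<in> I \<Longrightarrow> X i \<in> measurable M (count_space UNIV)"
    and ind: "indep_sets ?E I"
    using X by (auto simp: indep_vars_def2)
  have X_i: "(\<lambda>\<omega>. g (X i \<omega>)) \<in> borel_measurable (gen X {i})"
    by (rule measurable_compose[OF measurable_gen_component]) auto
  have "indep_sets (\<lambda>b. sigma_sets (space M) (\<Union>i\<in>case_bool {i} J b. ?E i)) UNIV"
  proof (rule indep_sets_collect_sigma)
    show "indep_sets ?E (\<Union>b\<in>UNIV. case_bool {i} J b)"
      by (rule indep_sets_mono_index[OF _ ind]) (use J in \<open>auto split: bool.splits\<close>)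
    show "disjoint_family_on (case_bool {i} J) UNIV"
      using J by (auto simp: disjoint_family_on_def split: bool.splits)
    show "Int_stable (?E k)" for k
      by (auto simp: Int_stable_def) (metis vimage_Int inf.assoc inf.left_commute inf.idem)
  qed
  then have ind': "indep_sets (case_bool (sets (gen X {i})) (sets (gen X J))) UNIV"
    by (rule indep_sets_mono_sets) (auto simp: sets_gen split: bool.splits)
  have sub: "sigma_sets (space M) {h -` A \<inter> space M | A. A \<in> sets borel} \<subseteq> sets (gen X K)"
    if "h \<in> borel_measurable (gen X K)" for h :: "'a \<Rightarrow> real" and K
    using sets.sigma_sets_subset[of "{h -` A \<inter> space M | A. A \<in> sets borel}" "gen X K"]
      measurable_sets[OF that] by auto
  have "indep_set (sigma_sets (space M) {(\<lambda>\<omega>. g (X i \<omega>)) -` A \<inter> space M | A. A \<in> sets borel})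
      (sigma_sets (space M) {f -` A \<inter> space M | A. A \<in> sets borel})"
    unfolding indep_set_def using sub[OF X_i] sub[OF f]
    by (intro indep_sets_mono_sets[OF ind']) (auto split: bool.splits)
  moreover have "random_variable borel (\<lambda>\<omega>. g (X i \<omega>))"
    by (rule measurable_compose[OF rv[OF J(2)]]) auto
  moreover have "random_variable borel f"
    by (rule measurable_from_subalg[OF subalgebra_gen f]) (use J rv in auto)
  ultimately show ?thesis by (simp add: indep_var_eq)
qed

text \<open>Replaces conditioning on the past: a primitive variable outside \<open>J\<close> may be
  integrated separately from anything built from \<open>J\<close>.\<close>

lemma
  fixes X :: "'i \<Rightarrow> 'a \<Rightarrow> nat" and g :: "nat \<Rightarrow> real"
  assumes X: "indep_vars (\<lambda>_. count_space UNIV) X I" and J: "J \<subseteq> I" "i \<in> I" "i \<notin> J"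
    and f: "f \<in> borel_measurable (gen X J)"
    and g: "integrable M (\<lambda>\<omega>. g (X i \<omega>))" and fi: "integrable M f"
  shows expectation_gen_mult:
      "(\<integral>\<omega>. g (X i \<omega>) * f \<omega> \<partial>M) = (\<integral>\<omega>. g (X i \<omega>) \<partial>M) * (\<integral>\<omega>. f \<omega> \<partial>M)"
    and integrable_gen_mult: "integrable M (\<lambda>\<omega>. g (X i \<omega>) * f \<omega>)"
  using indep_var_lebesgue_integral[OF indep_var_gen[OF X J f] g fi]
    indep_var_integrable[OF indep_var_gen[OF X J f] g fi] by auto

end

section \<open>The INAR(1) model, its filtration and its noise\<close>

locale inar = prob_space M for M :: "'w measure" +
  fixes \<alpha> :: real and X0 :: "'w \<Rightarrow> nat" and eps :: "nat \<Rightarrow> 'w \<Rightarrow> nat"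
    and xi :: "nat \<Rightarrow> nat \<Rightarrow> 'w \<Rightarrow> nat"
  assumes \<alpha>: "0 < \<alpha>" "\<alpha> < 1"
    and indep: "indep_vars (\<lambda>_. count_space UNIV) (inar_family X0 eps xi) inar_index_set"
    and eps_distr: "1 \<le> k \<Longrightarrow> distr M (count_space UNIV) (eps k) = distr M (count_space UNIV) (eps 1)"
    and eps_sq: "integrable M (\<lambda>\<omega>. (real (eps 1 \<omega>))\<^sup>2)"
    and eps_nz: "measure M {\<omega> \<in> space M. eps 1 \<omega> \<noteq> 0} > 0"
    and xi_le: "1 \<le> k \<Longrightarrow> 1 \<le> j \<Longrightarrow> AE \<omega> in M. xi k j \<omega> \<le> 1"
    and xi_prob: "1 \<le> k \<Longrightarrow> 1 \<le> j \<Longrightarrow> measure M {\<omega> \<in> space M. xi k j \<omega> = 1} = \<alpha>"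
    and X0_sq: "integrable M (\<lambda>\<omega>. (real (X0 \<omega>))\<^sup>2)"
begin

abbreviation fam :: "inar_idx \<Rightarrow> 'w \<Rightarrow> nat" where "fam \<equiv> inar_family X0 eps xi"
abbreviation X :: "nat \<Rightarrow> 'w \<Rightarrow> nat" where "X \<equiv> inarX X0 eps xi"

definition \<mu> :: real where "\<mu> = (\<integral>\<omega>. real (eps 1 \<omega>) \<partial>M)"
definition q :: real where "q = measure M {\<omega> \<in> space M. eps 1 \<omega> \<noteq> 0}"
definition \<sigma>2 :: real where "\<sigma>2 = (\<integral>\<omega>. (real (eps 1 \<omega>) - \<mu>)\<^sup>2 \<partial>M)"

text \<open>All \<open>Xi i j\<close> of a step are included, without a bound on \<open>j\<close>,
  because the number of them that enters \<open>X i\<close> is random.\<close>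

definition past :: "nat \<Rightarrow> inar_idx set" where
  "past k = {Init} \<union> {Eps i | i. 1 \<le> i \<and> i \<le> k} \<union> {Xi i j | i j. 1 \<le> i \<and> i \<le> k \<and> 1 \<le> j}"

definition F :: "nat \<Rightarrow> 'w measure" where "F k = gen fam (past k)"

lemma fam_simps [simp]: "fam Init = X0" "fam (Eps k) = eps k" "fam (Xi k j) = xi k j"
  by (auto simp: inar_family_def)

lemma past_subset: "past k \<subseteq> inar_index_set"
  by (auto simp: past_def inar_index_set_def)

lemma idx [simp]: "Init \<in> inar_index_set" "Eps k \<in> inar_index_set \<longleftrightarrow> 1 \<le> k"
  "Xi k j \<in> inar_index_set \<longleftrightarrow> 1 \<le> k \<and> 1 \<le> j"
  by (auto simp: inar_index_set_def)

lemma fam_meas: "i \<in> inar_index_set \<Longrightarrow> fam i \<in> measurable M (count_space UNIV)"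
  using indep by (auto simp: indep_vars_def2)

lemma subalg_gen: "J \<subseteq> inar_index_set \<Longrightarrow> subalgebra M (gen fam J)"
  by (rule subalgebra_gen) (auto intro: fam_meas)

lemma subalg_F: "subalgebra M (F k)"
  unfolding F_def by (rule subalg_gen[OF past_subset])

lemma past_mono: "i \<le> k \<Longrightarrow> past i \<subseteq> past k"
  by (auto simp: past_def)

lemma X_meas: "X k \<in> measurable (F k) (count_space UNIV)"
proof (induction k)
  case 0
  have "X 0 = fam Init" by (simp add: fun_eq_iff)
  then show ?case unfolding F_def by (simp only:) (rule measurable_gen_component, simp add: past_def)
next
  case (Suc k)
  have [measurable]: "X k \<in> measurable (F (Suc k)) (count_space UNIV)"
    using Suc past_mono[of k "Suc k"] unfolding F_def by (auto intro: measurable_gen_mono)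
  have comp: "fam i \<in> borel_measurable (F (Suc k))" if "i \<in> past (Suc k)" for i
    unfolding F_def measurable_count_space_nat_iff[symmetric] by (rule measurable_gen_component[OF that])
  have e: "eps (Suc k) \<in> borel_measurable (F (Suc k))"
    using comp[of "Eps (Suc k)"] by (simp add: past_def)
  have x: "xi (Suc k) j \<in> borel_measurable (F (Suc k))" if "j \<ge> 1" for j
    using comp[of "Xi (Suc k) j"] that by (simp add: past_def)
  \<comment> \<open>The upper limit of the sum is the random \<open>X k\<close>; as it takes
    countably many values, measurability is checked for each fixed \<open>n\<close>.\<close>
  have "(\<lambda>\<omega>. (\<lambda>n \<omega>. (\<Sum>j=1..n. xi (Suc k) j \<omega>) + eps (Suc k) \<omega>) (X k \<omega>) \<omega>)
      \<in> measurable (F (Suc k)) (count_space UNIV)"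
  proof (rule measurable_compose_countable[where g = "X k"
        and f = "\<lambda>n \<omega>. (\<Sum>j=1..n. xi (Suc k) j \<omega>) + eps (Suc k) \<omega>"])
    show "(\<lambda>\<omega>. (\<Sum>j=1..n. xi (Suc k) j \<omega>) + eps (Suc k) \<omega>) \<in> measurable (F (Suc k)) (count_space UNIV)" for n
      unfolding measurable_count_space_nat_iff
      by (intro borel_measurable_add borel_measurable_sum e x) simp
  qed fact
  then show ?case by simp
qed

lemma eps_integral:
  fixes g :: "nat \<Rightarrow> real"
  assumes "1 \<le> k"
  shows "(\<integral>\<omega>. g (eps k \<omega>) \<partial>M) = (\<integral>\<omega>. g (eps 1 \<omega>) \<partial>M)"
    and "integrable M (\<lambda>\<omega>. g (eps k \<omega>)) \<longleftrightarrow> integrable M (\<lambda>\<omega>. g (eps 1 \<omega>))"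
proof -
  have m: "eps k \<in> measurable M (count_space UNIV)" "eps 1 \<in> measurable M (count_space UNIV)"
    using fam_meas[of "Eps k"] fam_meas[of "Eps 1"] assms by auto
  show "(\<integral>\<omega>. g (eps k \<omega>) \<partial>M) = (\<integral>\<omega>. g (eps 1 \<omega>) \<partial>M)"
    using integral_distr[OF m(1), of g] integral_distr[OF m(2), of g] eps_distr[OF assms] by simp
  show "integrable M (\<lambda>\<omega>. g (eps k \<omega>)) \<longleftrightarrow> integrable M (\<lambda>\<omega>. g (eps 1 \<omega>))"
    using integrable_distr_eq[OF m(1), of g] integrable_distr_eq[OF m(2), of g] eps_distr[OF assms] by simp
qed

lemma eps_meas [measurable]: "1 \<le> k \<Longrightarrow> eps k \<in> measurable M (count_space UNIV)"
  using fam_meas[of "Eps k"] by simp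

lemma xi_meas [measurable]: "1 \<le> k \<Longrightarrow> 1 \<le> j \<Longrightarrow> xi k j \<in> measurable M (count_space UNIV)"
  using fam_meas[of "Xi k j"] by simp

lemma eps_centred:
  assumes "1 \<le> k"
  shows "integrable M (\<lambda>\<omega>. real (eps k \<omega>) - \<mu>)" "(\<integral>\<omega>. real (eps k \<omega>) - \<mu> \<partial>M) = 0"
    "integrable M (\<lambda>\<omega>. (real (eps k \<omega>) - \<mu>)\<^sup>2)" "(\<integral>\<omega>. (real (eps k \<omega>) - \<mu>)\<^sup>2 \<partial>M) = \<sigma>2"
proof -
  have [measurable]: "eps 1 \<in> measurable M (count_space UNIV)" by (rule eps_meas) simp
  have i1: "integrable M (\<lambda>\<omega>. real (eps 1 \<omega>))"
    by (rule square_integrable_imp_integrable[OF _ eps_sq]) measurable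
  then have "integrable M (\<lambda>\<omega>. real (eps 1 \<omega>) - \<mu>)" by simp
  then show "integrable M (\<lambda>\<omega>. real (eps k \<omega>) - \<mu>)"
    using eps_integral(2)[OF assms, of "\<lambda>n. real n - \<mu>"] by simp
  have "(\<integral>\<omega>. real (eps 1 \<omega>) - \<mu> \<partial>M) = 0" using i1 by (simp add: \<mu>_def prob_space)
  then show "(\<integral>\<omega>. real (eps k \<omega>) - \<mu> \<partial>M) = 0"
    using eps_integral(1)[OF assms, of "\<lambda>n. real n - \<mu>"] by simp
  have "integrable M (\<lambda>\<omega>. (real (eps 1 \<omega>) - \<mu>)\<^sup>2)"
    using i1 eps_sq by (simp add: power2_diff)
  then show "integrable M (\<lambda>\<omega>. (real (eps k \<omega>) - \<mu>)\<^sup>2)"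
    using eps_integral(2)[OF assms, of "\<lambda>n. (real n - \<mu>)\<^sup>2"] by simp
  show "(\<integral>\<omega>. (real (eps k \<omega>) - \<mu>)\<^sup>2 \<partial>M) = \<sigma>2"
    using eps_integral(1)[OF assms, of "\<lambda>n. (real n - \<mu>)\<^sup>2"] by (simp add: \<sigma>2_def)
qed

lemma eps_nz_centred:
  assumes "1 \<le> k"
  shows "(\<integral>\<omega>. of_bool (eps k \<omega> \<noteq> 0) - q \<partial>M) = 0"
proof -
  have [measurable]: "eps 1 \<in> measurable M (count_space UNIV)" by (rule eps_meas) simp
  have "(\<integral>\<omega>. of_bool (eps 1 \<omega> \<noteq> 0) \<partial>M) = (\<integral>\<omega>. indicator {\<omega> \<in> space M. eps 1 \<omega> \<noteq> 0} \<omega> \<partial>M)"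
    by (rule Bochner_Integration.integral_cong) (auto simp: indicator_def)
  also have "\<dots> = q" by (simp add: q_def)
  finally have "(\<integral>\<omega>. of_bool (eps 1 \<omega> \<noteq> 0) \<partial>M) = q" .
  moreover have "integrable M (\<lambda>\<omega>. of_bool (eps 1 \<omega> \<noteq> 0) :: real)"
    by (rule integrable_const_bound[of _ 1]) (auto, measurable)
  ultimately have "(\<integral>\<omega>. of_bool (eps 1 \<omega> \<noteq> 0) - q \<partial>M) = 0" by (simp add: prob_space)
  then show ?thesis using eps_integral(1)[OF assms, of "\<lambda>n. of_bool (n \<noteq> 0) - q"] by simp
qed

lemma xi_centred:
  assumes "1 \<le> k" "1 \<le> j"
  shows "integrable M (\<lambda>\<omega>. real (xi k j \<omega>) - \<alpha>)" "(\<integral>\<omega>. real (xi k j \<omega>) - \<alpha> \<partial>M) = 0"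
    "integrable M (\<lambda>\<omega>. (real (xi k j \<omega>) - \<alpha>)\<^sup>2)" "(\<integral>\<omega>. (real (xi k j \<omega>) - \<alpha>)\<^sup>2 \<partial>M) \<le> 1"
proof -
  note [measurable] = xi_meas[OF assms]
  note le = xi_le[OF assms]
  have i: "integrable M (\<lambda>\<omega>. real (xi k j \<omega>))"
    by (rule integrable_const_bound[of _ 1]) (use le in auto)
  then show "integrable M (\<lambda>\<omega>. real (xi k j \<omega>) - \<alpha>)" by simp
  have "(\<integral>\<omega>. real (xi k j \<omega>) \<partial>M) = (\<integral>\<omega>. indicator {\<omega> \<in> space M. xi k j \<omega> = 1} \<omega> \<partial>M)"
  proof (rule integral_cong_AE)
    show "AE \<omega> in M. real (xi k j \<omega>) = indicator {\<omega> \<in> space M. xi k j \<omega> = 1} \<omega>"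
      using le AE_space by eventually_elim (auto simp: indicator_def le_Suc_eq)
  qed measurable
  also have "\<dots> = \<alpha>" using xi_prob[OF assms] by simp
  finally show "(\<integral>\<omega>. real (xi k j \<omega>) - \<alpha> \<partial>M) = 0" using i by (simp add: prob_space)
  have b: "AE \<omega> in M. (real (xi k j \<omega>) - \<alpha>)\<^sup>2 \<le> 1"
    using le
  proof eventually_elim
    case (elim \<omega>)
    then have "\<bar>real (xi k j \<omega>) - \<alpha>\<bar> \<le> 1" using \<alpha> by (auto simp: abs_le_iff)
    then show ?case by (simp add: abs_square_le_1)
  qed
  show s: "integrable M (\<lambda>\<omega>. (real (xi k j \<omega>) - \<alpha>)\<^sup>2)"
    by (rule integrable_const_bound[of _ 1]) (use b in auto)
  have "(\<integral>\<omega>. (real (xi k j \<omega>) - \<alpha>)\<^sup>2 \<partial>M) \<le> (\<integral>\<omega>. 1 \<partial>M)"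
    by (rule integral_mono_AE[OF s _ b]) simp
  then show "(\<integral>\<omega>. (real (xi k j \<omega>) - \<alpha>)\<^sup>2 \<partial>M) \<le> 1" by (simp add: prob_space)
qed

definition z :: "nat \<Rightarrow> 'w \<Rightarrow> real" where
  "z k \<omega> = real (X (Suc k) \<omega>) - \<alpha> * real (X k \<omega>) - \<mu>"

lemma F_measurable_M: "f \<in> measurable (F k) N \<Longrightarrow> f \<in> measurable M N"
  by (rule measurable_from_subalg[OF subalg_F])

lemma X_measurable_M [measurable]: "X k \<in> measurable M (count_space UNIV)"
  by (rule F_measurable_M[OF X_meas])

lemma z_meas: "z k \<in> borel_measurable (F (Suc k))"
proof -
  have [measurable]: "X k \<in> measurable (F (Suc k)) (count_space UNIV)" "X (Suc k) \<in> measurable (F (Suc k)) (count_space UNIV)"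
    using X_meas[of k] X_meas[of "Suc k"] past_mono[of k "Suc k"] unfolding F_def
    by (auto intro: measurable_gen_mono)
  show ?thesis unfolding z_def[abs_def] by measurable
qed

lemma bounded_integrable:
  fixes f :: "'w \<Rightarrow> real"
  assumes "f \<in> borel_measurable M" "\<And>\<omega>. \<bar>f \<omega>\<bar> \<le> B"
  shows "integrable M f"
  by (rule integrable_const_bound[of _ B]) (use assms in auto)

lemma square_integrable_imp:
  fixes f :: "'w \<Rightarrow> real"
  assumes "f \<in> borel_measurable M" "integrable M (\<lambda>\<omega>. (f \<omega>)\<^sup>2)"
  shows "integrable M f"
  by (rule square_integrable_imp_integrable[OF assms])

text \<open>Marks the Bernoulli variables that are really summed at step \<open>Suc k\<close>. It is
  known at time \<open>k\<close> and so turns a random number of summands into a sum of fixed length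
  with predictable weights.\<close>

definition thin :: "nat \<Rightarrow> nat \<Rightarrow> 'w \<Rightarrow> real" where
  "thin k j \<omega> = of_bool (j \<le> X k \<omega>)"

text \<open>The condition on \<open>w\<close> caps the number of relevant summands at
  \<open>K\<close>. What results is a finite sum of centred primitive variables with weights that,
  in the applications, are known at time \<open>k\<close>.\<close>

lemma weighted_noise_eq:
  assumes "K < X k \<omega> \<Longrightarrow> w = 0"
  shows "w * z k \<omega> = (real (eps (Suc k) \<omega>) - \<mu>) * w
     + (\<Sum>j=1..K. (real (xi (Suc k) j \<omega>) - \<alpha>) * (w * thin k j \<omega>))"
proof (cases "K < X k \<omega>")
  case False
  have "(\<Sum>j=1..K. (real (xi (Suc k) j \<omega>) - \<alpha>) * (w * thin k j \<omega>))
      = (\<Sum>j=1..X k \<omega>. (real (xi (Suc k) j \<omega>) - \<alpha>) * w)"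
    using False by (intro sum.mono_neutral_cong_right) (auto simp: thin_def)
  also have "\<dots> = (\<Sum>j=1..X k \<omega>. real (xi (Suc k) j \<omega>) - \<alpha>) * w"
    by (simp only: sum_distrib_right)
  also have "(\<Sum>j=1..X k \<omega>. real (xi (Suc k) j \<omega>) - \<alpha>)
      = (\<Sum>j=1..X k \<omega>. real (xi (Suc k) j \<omega>)) - \<alpha> * real (X k \<omega>)"
    by (simp add: sum_subtractf)
  finally have sum: "(\<Sum>j=1..K. (real (xi (Suc k) j \<omega>) - \<alpha>) * (w * thin k j \<omega>))
      = ((\<Sum>j=1..X k \<omega>. real (xi (Suc k) j \<omega>)) - \<alpha> * real (X k \<omega>)) * w" .
  show ?thesis unfolding sum by (simp add: z_def algebra_simps)
qed (use assms in simp)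

lemma thin_meas: "thin k j \<in> borel_measurable (F k)"
proof -
  note [measurable] = X_meas
  show ?thesis unfolding thin_def[abs_def] by measurable
qed

lemma eps_orth:
  assumes f: "f \<in> borel_measurable (F k)" "integrable M f"
  shows "integrable M (\<lambda>\<omega>. (real (eps (Suc k) \<omega>) - \<mu>) * f \<omega>)"
    and "(\<integral>\<omega>. (real (eps (Suc k) \<omega>) - \<mu>) * f \<omega> \<partial>M) = 0"
  using integrable_gen_mult[OF indep past_subset _ _ f(1)[unfolded F_def], of "Eps (Suc k)" "\<lambda>n. real n - \<mu>"]
    expectation_gen_mult[OF indep past_subset _ _ f(1)[unfolded F_def], of "Eps (Suc k)" "\<lambda>n. real n - \<mu>"]
    eps_centred[of "Suc k"] f(2)
  by (simp_all add: past_def)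

text \<open>\<open>J\<close> is left free because the other factor may contain further variables of
  step \<open>Suc k\<close>: Bernoulli variables of smaller index in \<open>noise_square\<close>, of
  larger index for the jumps.\<close>

lemma xi_orth:
  assumes J: "J \<subseteq> inar_index_set" "Xi (Suc k) j \<notin> J" "1 \<le> j"
    and f: "f \<in> borel_measurable (gen fam J)" "integrable M f"
  shows "integrable M (\<lambda>\<omega>. (real (xi (Suc k) j \<omega>) - \<alpha>) * f \<omega>)"
    and "(\<integral>\<omega>. (real (xi (Suc k) j \<omega>) - \<alpha>) * f \<omega> \<partial>M) = 0"
  using integrable_gen_mult[OF indep J(1) _ J(2) f(1), of "\<lambda>n. real n - \<alpha>"]
    expectation_gen_mult[OF indep J(1) _ J(2) f(1), of "\<lambda>n. real n - \<alpha>"]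
    xi_centred[of "Suc k" j] f(2) J(3)
  by simp_all

text \<open>In the finite decomposition each summand is a centred primitive variable times a
  function known at time \<open>k\<close>, so it integrates to 0. Boundedness of \<open>w\<close>
  keeps every summand integrable.\<close>

lemma noise_orth:
  assumes w: "w \<in> borel_measurable (F k)" "\<And>\<omega>. \<bar>w \<omega>\<bar> \<le> B" "\<And>\<omega>. K < X k \<omega> \<Longrightarrow> w \<omega> = 0"
    and f: "f \<in> borel_measurable (F k)" "integrable M f"
  shows "(\<integral>\<omega>. (w \<omega> * z k \<omega>) * f \<omega> \<partial>M) = 0"
proof -
  have bm: "integrable M (\<lambda>\<omega>. h \<omega> * f \<omega>)" if "h \<in> borel_measurable (F k)" "\<And>\<omega>. \<bar>h \<omega>\<bar> \<le> B" for h
  proof (rule Bochner_Integration.integrable_bound)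
    show "integrable M (\<lambda>\<omega>. B * f \<omega>)" using f(2) by simp
    show "(\<lambda>\<omega>. h \<omega> * f \<omega>) \<in> borel_measurable M"
      using that(1) f(1) by (intro borel_measurable_times F_measurable_M)
    have "0 \<le> B" using that(2) abs_ge_zero order_trans by blast
    then show "AE \<omega> in M. norm (h \<omega> * f \<omega>) \<le> norm (B * f \<omega>)"
      using that(2) by (intro AE_I2) (simp add: abs_mult mult_right_mono)
  qed
  have wt: "(\<lambda>\<omega>. w \<omega> * thin k j \<omega>) \<in> borel_measurable (F k)" for j
    by (intro borel_measurable_times w thin_meas)
  have wtb: "\<bar>w \<omega> * thin k j \<omega>\<bar> \<le> B" for j \<omega>
    using w(2)[of \<omega>] by (auto simp: thin_def)
  have e: "integrable M (\<lambda>\<omega>. (real (eps (Suc k) \<omega>) - \<mu>) * (w \<omega> * f \<omega>))"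
      "(\<integral>\<omega>. (real (eps (Suc k) \<omega>) - \<mu>) * (w \<omega> * f \<omega>) \<partial>M) = 0"
    by (intro eps_orth borel_measurable_times w f bm)+
  have x: "integrable M (\<lambda>\<omega>. (real (xi (Suc k) j \<omega>) - \<alpha>) * ((w \<omega> * thin k j \<omega>) * f \<omega>))"
      "(\<integral>\<omega>. (real (xi (Suc k) j \<omega>) - \<alpha>) * ((w \<omega> * thin k j \<omega>) * f \<omega>) \<partial>M) = 0"
    if "j \<in> {1..K}" for j
    using that wt[of j] f(1) bm[OF wt wtb]
    by (intro xi_orth[OF past_subset[of k]]; auto simp: past_def F_def intro!: borel_measurable_times)+
  have eq: "(w \<omega> * z k \<omega>) * f \<omega> = (real (eps (Suc k) \<omega>) - \<mu>) * (w \<omega> * f \<omega>)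
     + (\<Sum>j=1..K. (real (xi (Suc k) j \<omega>) - \<alpha>) * ((w \<omega> * thin k j \<omega>) * f \<omega>))" for \<omega>
    by (subst weighted_noise_eq[of K], erule w(3)) (simp add: distrib_right sum_distrib_right mult.assoc)
  let ?T = "\<lambda>j \<omega>. (real (xi (Suc k) j \<omega>) - \<alpha>) * ((w \<omega> * thin k j \<omega>) * f \<omega>)"
  have "(\<integral>\<omega>. (\<Sum>j=1..K. ?T j \<omega>) \<partial>M) = (\<Sum>j=1..K. \<integral>\<omega>. ?T j \<omega> \<partial>M)"
    by (rule Bochner_Integration.integral_sum, rule x(1))
  moreover have "integrable M (\<lambda>\<omega>. \<Sum>j=1..K. ?T j \<omega>)"
    by (rule Bochner_Integration.integrable_sum, rule x(1))
  ultimately show ?thesis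
    unfolding eq using x(2) e by (subst Bochner_Integration.integral_add) simp_all
qed

text \<open>Given the past, \<open>z k\<close> is a sum of independent centred terms: the
  innovation, of variance \<open>\<sigma>2\<close>, and \<open>X k\<close> Bernoulli terms of
  variance at most 1. The proof avoids conditional expectations by adding the Bernoulli terms one at
  a time.\<close>

lemma noise_square:
  assumes w: "w \<in> borel_measurable (F k)" "\<And>\<omega>. \<bar>w \<omega>\<bar> \<le> B" "\<And>\<omega>. K < X k \<omega> \<Longrightarrow> w \<omega> = 0"
  shows "integrable M (\<lambda>\<omega>. (w \<omega> * z k \<omega>)\<^sup>2)"
    and "integrable M (\<lambda>\<omega>. (w \<omega>)\<^sup>2 * (\<sigma>2 + real (X k \<omega>)))"
    and "(\<integral>\<omega>. (w \<omega> * z k \<omega>)\<^sup>2 \<partial>M) \<le> (\<integral>\<omega>. (w \<omega>)\<^sup>2 * (\<sigma>2 + real (X k \<omega>)) \<partial>M)"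
proof -
  \<comment> \<open>Information carried by the partial sum with \<open>J\<close> Bernoulli terms.
    The variable number \<open>Suc J\<close> is independent of it, which makes the cross term vanish
    in the induction.\<close>
  define H where "H J = gen fam (past k \<union> {Eps (Suc k)} \<union> {Xi (Suc k) j | j. 1 \<le> j \<and> j \<le> J})" for J
  have HI: "past k \<union> {Eps (Suc k)} \<union> {Xi (Suc k) j | j. 1 \<le> j \<and> j \<le> J} \<subseteq> inar_index_set" for J
    using past_subset[of k] by auto
  have HM: "f \<in> borel_measurable (H J) \<Longrightarrow> f \<in> borel_measurable M" for f :: "'w \<Rightarrow> real" and J
    unfolding H_def by (rule measurable_from_subalg[OF subalg_gen[OF HI]])
  have FH: "f \<in> borel_measurable (F k) \<Longrightarrow> f \<in> borel_measurable (H J)" for f :: "'w \<Rightarrow> real" and J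
    unfolding H_def F_def by (rule measurable_gen_mono) auto
  define V where "V J \<omega> = (real (eps (Suc k) \<omega>) - \<mu>) * w \<omega>
     + (\<Sum>j=1..J. (real (xi (Suc k) j \<omega>) - \<alpha>) * (w \<omega> * thin k j \<omega>))" for J \<omega>
  have wM [measurable]: "w \<in> borel_measurable M" by (rule F_measurable_M[OF w(1)])
  have tM [measurable]: "thin k j \<in> borel_measurable M" for j by (rule F_measurable_M[OF thin_meas])
  have B: "0 \<le> B" using w(2) abs_ge_zero order_trans by blast
  have w2: "(w \<omega>)\<^sup>2 \<le> B\<^sup>2" for \<omega> using w(2)[of \<omega>] B by (simp add: abs_le_square_iff[symmetric])
  have V_meas: "V J \<in> borel_measurable (H J)" for J
  proof -
    have "eps (Suc k) \<in> measurable (H J) (count_space UNIV)"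
      using measurable_gen_component[of "Eps (Suc k)" _ fam] unfolding H_def by simp
    then have e: "(\<lambda>\<omega>. real (eps (Suc k) \<omega>)) \<in> borel_measurable (H J)"
      by (rule measurable_compose) simp
    have x: "(\<lambda>\<omega>. real (xi (Suc k) j \<omega>)) \<in> borel_measurable (H J)" if "j \<in> {1..J}" for j
    proof (rule measurable_compose[where g = real and N = "count_space UNIV"])
      show "xi (Suc k) j \<in> measurable (H J) (count_space UNIV)"
        using measurable_gen_component[of "Xi (Suc k) j" _ fam] that unfolding H_def by simp
    qed simp
    show ?thesis
      unfolding V_def[abs_def]
      by (intro borel_measurable_add borel_measurable_times borel_measurable_sum borel_measurable_diff
          borel_measurable_const e FH[OF w(1)] FH[OF thin_meas] x)
  qed
  have int_wt: "integrable M (\<lambda>\<omega>. (w \<omega>)\<^sup>2 * (\<sigma>2 + (\<Sum>j=1..J. thin k j \<omega>)))" for J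
  proof (rule bounded_integrable[where B = "B\<^sup>2 * (\<bar>\<sigma>2\<bar> + real J)"])
    fix \<omega>
    have "\<bar>\<Sum>j=1..J. thin k j \<omega>\<bar> \<le> (\<Sum>j=1..J. 1)"
      by (rule order_trans[OF sum_abs]) (rule sum_mono, simp add: thin_def)
    then have "\<bar>\<sigma>2 + (\<Sum>j=1..J. thin k j \<omega>)\<bar> \<le> \<bar>\<sigma>2\<bar> + real J" by simp
    then show "\<bar>(w \<omega>)\<^sup>2 * (\<sigma>2 + (\<Sum>j=1..J. thin k j \<omega>))\<bar> \<le> B\<^sup>2 * (\<bar>\<sigma>2\<bar> + real J)"
      using w2[of \<omega>] by (simp add: abs_mult mult_mono)
  qed measurable
  have V: "integrable M (\<lambda>\<omega>. (V J \<omega>)\<^sup>2) \<and>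
      (\<integral>\<omega>. (V J \<omega>)\<^sup>2 \<partial>M) \<le> (\<integral>\<omega>. (w \<omega>)\<^sup>2 * (\<sigma>2 + (\<Sum>j=1..J. thin k j \<omega>)) \<partial>M)" for J
  proof (induction J)
    case 0
    have wi: "(\<lambda>\<omega>. (w \<omega>)\<^sup>2) \<in> borel_measurable (gen fam (past k))"
      using w(1) unfolding F_def by simp
    have wI: "integrable M (\<lambda>\<omega>. (w \<omega>)\<^sup>2)"
      by (rule bounded_integrable[where B = "B\<^sup>2"]) (use w2 in auto)
    have eq: "(V 0 \<omega>)\<^sup>2 = (real (eps (Suc k) \<omega>) - \<mu>)\<^sup>2 * (w \<omega>)\<^sup>2" for \<omega>
      by (simp add: V_def power_mult_distrib)
    show ?case
      unfolding eq
      using integrable_gen_mult[OF indep past_subset _ _ wi, of "Eps (Suc k)" "\<lambda>n. (real n - \<mu>)\<^sup>2"]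
        expectation_gen_mult[OF indep past_subset _ _ wi, of "Eps (Suc k)" "\<lambda>n. (real n - \<mu>)\<^sup>2"]
        eps_centred[of "Suc k"] wI
      by (simp add: past_def mult.commute)
  next
    case (Suc J)
    let ?g = "\<lambda>\<omega>. w \<omega> * thin k (Suc J) \<omega>"
    have gF: "?g \<in> borel_measurable (F k)" by (intro borel_measurable_times w thin_meas)
    have gb: "\<bar>?g \<omega>\<bar> \<le> B" for \<omega> using w(2)[of \<omega>] B by (auto simp: thin_def)
    have VM: "V J \<in> borel_measurable M" by (rule HM[OF V_meas])
    have gM: "?g \<in> borel_measurable M" by measurable
    have gV: "integrable M (\<lambda>\<omega>. ?g \<omega> * V J \<omega>)"
      by (rule square_integrable_imp)
        (use VM gM gb Suc in \<open>auto intro!: square_integrable_bounded_mult[of _ _ _ B]\<close>)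
    have gVH: "(\<lambda>\<omega>. ?g \<omega> * V J \<omega>) \<in> borel_measurable (H J)"
      by (intro borel_measurable_times V_meas FH w thin_meas)
    have notin: "Xi (Suc k) (Suc J) \<notin> past k \<union> {Eps (Suc k)} \<union> {Xi (Suc k) j | j. 1 \<le> j \<and> j \<le> J}"
      by (auto simp: past_def)
    have c: "integrable M (\<lambda>\<omega>. (real (xi (Suc k) (Suc J) \<omega>) - \<alpha>) * (?g \<omega> * V J \<omega>))"
      "(\<integral>\<omega>. (real (xi (Suc k) (Suc J) \<omega>) - \<alpha>) * (?g \<omega> * V J \<omega>) \<partial>M) = 0"
      by (rule xi_orth[OF HI notin _ gVH[unfolded H_def] gV]; simp)+
    have g2H: "(\<lambda>\<omega>. (?g \<omega>)\<^sup>2) \<in> borel_measurable (gen fam (past k))"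
      using gF unfolding F_def by simp
    have g2: "integrable M (\<lambda>\<omega>. (?g \<omega>)\<^sup>2)"
    proof (rule bounded_integrable[where B = "B\<^sup>2"])
      show "\<bar>(?g \<omega>)\<^sup>2\<bar> \<le> B\<^sup>2" for \<omega> using gb[of \<omega>] B by (simp add: abs_le_square_iff[symmetric])
    qed measurable
    have notin': "Xi (Suc k) (Suc J) \<notin> past k" by (auto simp: past_def)
    have s: "integrable M (\<lambda>\<omega>. (real (xi (Suc k) (Suc J) \<omega>) - \<alpha>)\<^sup>2 * (?g \<omega>)\<^sup>2)"
      "(\<integral>\<omega>. (real (xi (Suc k) (Suc J) \<omega>) - \<alpha>)\<^sup>2 * (?g \<omega>)\<^sup>2 \<partial>M) \<le> (\<integral>\<omega>. (?g \<omega>)\<^sup>2 \<partial>M)"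
      using integrable_gen_mult[OF indep past_subset _ notin' g2H, of "\<lambda>n. (real n - \<alpha>)\<^sup>2"]
        expectation_gen_mult[OF indep past_subset _ notin' g2H, of "\<lambda>n. (real n - \<alpha>)\<^sup>2"]
        xi_centred[of "Suc k" "Suc J"] g2
        mult_right_mono[of "\<integral>\<omega>. (real (xi (Suc k) (Suc J) \<omega>) - \<alpha>)\<^sup>2 \<partial>M" 1 "\<integral>\<omega>. (?g \<omega>)\<^sup>2 \<partial>M"]
      by simp_all
    have eq: "(V (Suc J) \<omega>)\<^sup>2 = (V J \<omega>)\<^sup>2
        + 2 * ((real (xi (Suc k) (Suc J) \<omega>) - \<alpha>) * (?g \<omega> * V J \<omega>))
        + (real (xi (Suc k) (Suc J) \<omega>) - \<alpha>)\<^sup>2 * (?g \<omega>)\<^sup>2" for \<omega>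
      by (simp add: V_def power2_eq_square algebra_simps)
    have int: "integrable M (\<lambda>\<omega>. (V (Suc J) \<omega>)\<^sup>2)"
      unfolding eq using Suc c s by simp
    have eq2: "(w \<omega>)\<^sup>2 * (\<sigma>2 + (\<Sum>j=1..J. thin k j \<omega>)) + (?g \<omega>)\<^sup>2
        = (w \<omega>)\<^sup>2 * (\<sigma>2 + (\<Sum>j=1..Suc J. thin k j \<omega>))" for \<omega>
      by (simp add: thin_def algebra_simps)
    have "(\<integral>\<omega>. (V (Suc J) \<omega>)\<^sup>2 \<partial>M) = (\<integral>\<omega>. (V J \<omega>)\<^sup>2 \<partial>M)
        + (\<integral>\<omega>. (real (xi (Suc k) (Suc J) \<omega>) - \<alpha>)\<^sup>2 * (?g \<omega>)\<^sup>2 \<partial>M)"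
      unfolding eq using Suc c s by simp
    also have "\<dots> \<le> (\<integral>\<omega>. (w \<omega>)\<^sup>2 * (\<sigma>2 + (\<Sum>j=1..J. thin k j \<omega>)) \<partial>M) + (\<integral>\<omega>. (?g \<omega>)\<^sup>2 \<partial>M)"
      using Suc s by (intro add_mono) auto
    also have "\<dots> = (\<integral>\<omega>. (w \<omega>)\<^sup>2 * (\<sigma>2 + (\<Sum>j=1..J. thin k j \<omega>)) + (?g \<omega>)\<^sup>2 \<partial>M)"
      by (rule Bochner_Integration.integral_add[symmetric, OF int_wt g2])
    finally show ?case using int unfolding eq2 by blast
  qed
  have wz: "w \<omega> * z k \<omega> = V K \<omega>" for \<omega>
    unfolding V_def by (rule weighted_noise_eq, erule w(3))
  have tX: "(w \<omega>)\<^sup>2 * (\<sigma>2 + (\<Sum>j=1..K. thin k j \<omega>)) = (w \<omega>)\<^sup>2 * (\<sigma>2 + real (X k \<omega>))" for \<omega>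
  proof (cases "K < X k \<omega>")
    case False
    then have "(\<Sum>j=1..K. thin k j \<omega>) = (\<Sum>j=1..X k \<omega>. 1)"
      by (intro sum.mono_neutral_cong_right) (auto simp: thin_def)
    then show ?thesis by simp
  qed (simp add: w(3))
  show "integrable M (\<lambda>\<omega>. (w \<omega> * z k \<omega>)\<^sup>2)"
    and "(\<integral>\<omega>. (w \<omega> * z k \<omega>)\<^sup>2 \<partial>M) \<le> (\<integral>\<omega>. (w \<omega>)\<^sup>2 * (\<sigma>2 + real (X k \<omega>)) \<partial>M)"
    using V[of K] unfolding wz tX by auto
  show "integrable M (\<lambda>\<omega>. (w \<omega>)\<^sup>2 * (\<sigma>2 + real (X k \<omega>)))"
    using int_wt[of K] unfolding tX .
qed

end

lemma Cesaro_cong: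
  fixes a b :: "nat \<Rightarrow> real"
  assumes ev: "\<forall>\<^sub>F k in sequentially. a k = b k" and a: "(\<lambda>n. (\<Sum>k<n. a k) / real n) \<longlonglongrightarrow> 0"
  shows "(\<lambda>n. (\<Sum>k<n. b k) / real n) \<longlonglongrightarrow> 0"
proof -
  obtain N where N: "\<And>k. k \<ge> N \<Longrightarrow> a k = b k" using ev by (auto simp: eventually_sequentially)
  define c where "c = (\<Sum>k<N. b k - a k)"
  have "(\<lambda>n. (\<Sum>k<n. a k) / real n + c / real n) \<longlonglongrightarrow> 0 + 0"
    by (intro tendsto_add a lim_const_over_n)
  moreover have "\<forall>\<^sub>F n in sequentially. (\<Sum>k<n. a k) / real n + c / real n = (\<Sum>k<n. b k) / real n"
    using eventually_ge_at_top[of N]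
  proof eventually_elim
    case (elim n)
    have "(\<Sum>k<n. b k - a k) = c"
      unfolding c_def by (rule sum.mono_neutral_right) (use elim N in auto)
    then show ?case by (simp add: sum_subtractf flip: add_divide_distrib)
  qed
  ultimately show ?thesis by (simp add: Lim_transform_eventually)
qed

section \<open>Bounded second moments and averages of the noise\<close>

context inar
begin

lemma \<sigma>2_nonneg: "\<sigma>2 \<ge> 0" by (simp add: \<sigma>2_def)

lemma X_measurable_F: "(\<lambda>\<omega>. real (X k \<omega>)) \<in> borel_measurable (F k)"
  by (rule measurable_compose[OF X_meas]) simp

text \<open>\<open>X (Suc k)\<close> is the sum of \<open>z k\<close> and its conditional mean
  \<open>l\<close>, which are orthogonal. As \<open>z k\<close> is not yet known to be square
  integrable, the expansion is done on \<open>X k \<le> K\<close>, where the noise lemmas apply, and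
  monotone convergence lets \<open>K\<close> grow.\<close>

lemma X_square_step:
  assumes sq: "integrable M (\<lambda>\<omega>. (real (X k \<omega>))\<^sup>2)"
  defines "b \<equiv> (\<integral>\<omega>. \<sigma>2 + real (X k \<omega>) + (\<alpha> * real (X k \<omega>) + \<mu>)\<^sup>2 \<partial>M)"
  shows "integrable M (\<lambda>\<omega>. (real (X (Suc k) \<omega>))\<^sup>2)" "(\<integral>\<omega>. (real (X (Suc k) \<omega>))\<^sup>2 \<partial>M) \<le> b"
proof -
  define w where "w K \<omega> = (of_bool (X k \<omega> \<le> K) :: real)" for K \<omega>
  define l where "l \<omega> = \<alpha> * real (X k \<omega>) + \<mu>" for \<omega>
  have XI: "integrable M (\<lambda>\<omega>. real (X k \<omega>))"
    by (rule square_integrable_imp[OF _ sq]) measurable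
  have lF: "l \<in> borel_measurable (F k)"
    unfolding l_def[abs_def] using X_measurable_F by measurable
  have wF: "w K \<in> borel_measurable (F k)" for K
  proof -
    note [measurable] = X_meas
    show ?thesis unfolding w_def[abs_def] by measurable
  qed
  have wb: "\<bar>w K \<omega>\<bar> \<le> 1" for K \<omega> by (simp add: w_def)
  have w0: "K < X k \<omega> \<Longrightarrow> w K \<omega> = 0" for K \<omega> by (simp add: w_def)
  have [measurable]: "w K \<in> borel_measurable M" "l \<in> borel_measurable M" "z k \<in> borel_measurable M" for K
    using wF lF z_meas F_measurable_M by blast+
  have lI: "integrable M (\<lambda>\<omega>. (l \<omega>)\<^sup>2)"
    unfolding l_def using sq XI by (simp add: power2_sum power_mult_distrib)
  have wlI: "integrable M (\<lambda>\<omega>. (w K \<omega> * l \<omega>)\<^sup>2)" for K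
    by (rule square_integrable_bounded_mult[OF _ _ lI wb]) measurable
  have wl: "integrable M (\<lambda>\<omega>. w K \<omega> * l \<omega>)" for K
    by (rule square_integrable_imp[OF _ wlI]) measurable
  note ns = noise_square[OF wF wb w0]
  have cross: "integrable M (\<lambda>\<omega>. (w K \<omega> * z k \<omega>) * (w K \<omega> * l \<omega>))" for K
    by (rule square_integrable_mult[OF _ _ ns(1) wlI]) measurable
  have cross0: "(\<integral>\<omega>. (w K \<omega> * z k \<omega>) * (w K \<omega> * l \<omega>) \<partial>M) = 0" for K
  proof (rule noise_orth[OF wF wb _ _ wl])
    show "w K \<omega> = 0" if "K < X k \<omega>" for \<omega> by (rule w0[OF that])
  qed (intro borel_measurable_times wF lF)
  define f where "f K \<omega> = (w K \<omega> * real (X (Suc k) \<omega>))\<^sup>2" for K \<omega>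
  have f: "f K \<omega> = (w K \<omega> * z k \<omega>)\<^sup>2 + (w K \<omega> * l \<omega>)\<^sup>2 + 2 * ((w K \<omega> * z k \<omega>) * (w K \<omega> * l \<omega>))" for K \<omega>
  proof -
    have "real (X (Suc k) \<omega>) = z k \<omega> + l \<omega>" by (simp add: z_def l_def)
    then show ?thesis unfolding f_def by (simp add: power2_eq_square algebra_simps)
  qed
  have fI: "integrable M (f K)" for K
    unfolding f using ns(1) wlI cross by simp
  have bound: "integral\<^sup>L M (f K) \<le> b" for K
  proof -
    have i1: "integrable M (\<lambda>\<omega>. (w K \<omega>)\<^sup>2 * (\<sigma>2 + real (X k \<omega>)) + (w K \<omega> * l \<omega>)\<^sup>2)"
      by (intro Bochner_Integration.integrable_add ns(2) wlI)
    have "integral\<^sup>L M (f K) = (\<integral>\<omega>. (w K \<omega> * z k \<omega>)\<^sup>2 \<partial>M) + (\<integral>\<omega>. (w K \<omega> * l \<omega>)\<^sup>2 \<partial>M)"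
      unfolding f using ns(1)[of K] wlI[of K] cross[of K] cross0[of K] by simp
    also have "\<dots> \<le> (\<integral>\<omega>. (w K \<omega>)\<^sup>2 * (\<sigma>2 + real (X k \<omega>)) \<partial>M) + (\<integral>\<omega>. (w K \<omega> * l \<omega>)\<^sup>2 \<partial>M)"
      by (intro add_right_mono ns(3))
    also have "\<dots> = (\<integral>\<omega>. (w K \<omega>)\<^sup>2 * (\<sigma>2 + real (X k \<omega>)) + (w K \<omega> * l \<omega>)\<^sup>2 \<partial>M)"
      by (rule Bochner_Integration.integral_add[symmetric, OF ns(2) wlI])
    also have "\<dots> \<le> b"
      unfolding b_def
    proof (rule integral_mono[OF i1])
      show "integrable M (\<lambda>\<omega>. \<sigma>2 + real (X k \<omega>) + (\<alpha> * real (X k \<omega>) + \<mu>)\<^sup>2)"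
        using XI lI unfolding l_def by simp
      show "(w K \<omega>)\<^sup>2 * (\<sigma>2 + real (X k \<omega>)) + (w K \<omega> * l \<omega>)\<^sup>2
          \<le> \<sigma>2 + real (X k \<omega>) + (\<alpha> * real (X k \<omega>) + \<mu>)\<^sup>2" for \<omega>
        using \<sigma>2_nonneg by (simp add: w_def l_def)
    qed
    finally show ?thesis .
  qed
  have mono: "mono (\<lambda>K. f K \<omega>)" for \<omega>
    by (auto simp: mono_def f_def w_def)
  have lim: "(\<lambda>K. f K \<omega>) \<longlonglongrightarrow> (real (X (Suc k) \<omega>))\<^sup>2" for \<omega>
  proof (rule tendsto_eventually)
    show "\<forall>\<^sub>F K in sequentially. f K \<omega> = (real (X (Suc k) \<omega>))\<^sup>2"
      using eventually_ge_at_top[of "X k \<omega>"] by eventually_elim (simp add: f_def w_def)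
  qed
  have m: "(\<lambda>\<omega>. (real (X (Suc k) \<omega>))\<^sup>2) \<in> borel_measurable M"
    by (intro borel_measurable_power measurable_compose[OF X_measurable_M]) simp
  show "integrable M (\<lambda>\<omega>. (real (X (Suc k) \<omega>))\<^sup>2)" "(\<integral>\<omega>. (real (X (Suc k) \<omega>))\<^sup>2 \<partial>M) \<le> b"
    using integrable_bounded_increasing[OF fI mono lim m bound] by auto
qed

text \<open>Since \<open>\<alpha>\<^sup>2 < 1\<close>, the recursion for second moments contracts;
  the linear term is absorbed at the price of half the contraction margin \<open>d\<close>.\<close>

lemma X_square_bounded:
  obtains B where "B \<ge> 0" "\<And>k. integrable M (\<lambda>\<omega>. (real (X k \<omega>))\<^sup>2)"
    "\<And>k. (\<integral>\<omega>. (real (X k \<omega>))\<^sup>2 \<partial>M) \<le> B"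
proof -
  define d where "d = 1 - \<alpha>\<^sup>2"
  have d: "d > 0" using \<alpha> by (simp add: d_def abs_square_less_1)
  define c where "c = 1 + 2 * \<alpha> * \<mu>"
  \<comment> \<open>The last summand of \<open>c0\<close> comes from
    \<open>c * x \<le> d / 2 * x\<^sup>2 + c\<^sup>2 / (2 * d)\<close>. \<open>B\<close> adds the
    initial moment to the fixed point \<open>c0 / (d / 2)\<close> of
    \<open>x \<mapsto> (1 - d / 2) * x + c0\<close>, so the recursion preserves it as an upper
    bound.\<close>
  define c0 where "c0 = \<sigma>2 + \<mu>\<^sup>2 + c\<^sup>2 / (2 * d)"
  have c0: "c0 \<ge> 0" using \<sigma>2_nonneg d by (simp add: c0_def)
  define B where "B = (\<integral>\<omega>. (real (X0 \<omega>))\<^sup>2 \<partial>M) + c0 / (d / 2)"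
  have B: "B \<ge> 0" using c0 d by (simp add: B_def)
  have pt: "\<sigma>2 + x + (\<alpha> * x + \<mu>)\<^sup>2 \<le> (1 - d / 2) * x\<^sup>2 + c0" for x
  proof -
    have "0 \<le> (d * x - c)\<^sup>2 / (2 * d)" using d by simp
    also have "\<dots> = d / 2 * x\<^sup>2 - c * x + c\<^sup>2 / (2 * d)"
      using d by (simp add: power2_eq_square field_simps)
    finally have "c * x \<le> d / 2 * x\<^sup>2 + c\<^sup>2 / (2 * d)" by simp
    moreover have "\<sigma>2 + x + (\<alpha> * x + \<mu>)\<^sup>2 = (1 - d) * x\<^sup>2 + c * x + \<sigma>2 + \<mu>\<^sup>2"
      by (simp add: d_def c_def power2_eq_square algebra_simps)
    ultimately show ?thesis by (simp add: c0_def algebra_simps)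
  qed
  have "integrable M (\<lambda>\<omega>. (real (X k \<omega>))\<^sup>2) \<and> (\<integral>\<omega>. (real (X k \<omega>))\<^sup>2 \<partial>M) \<le> B" for k
  proof (induction k)
    case 0
    show ?case using X0_sq c0 d by (simp add: B_def)
  next
    case (Suc k)
    then have sq: "integrable M (\<lambda>\<omega>. (real (X k \<omega>))\<^sup>2)" by simp
    have XI: "integrable M (\<lambda>\<omega>. real (X k \<omega>))"
      by (rule square_integrable_imp[OF _ sq]) measurable
    have "(\<integral>\<omega>. (real (X (Suc k) \<omega>))\<^sup>2 \<partial>M)
        \<le> (\<integral>\<omega>. \<sigma>2 + real (X k \<omega>) + (\<alpha> * real (X k \<omega>) + \<mu>)\<^sup>2 \<partial>M)"
      by (rule X_square_step(2)[OF sq])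
    also have "\<dots> \<le> (\<integral>\<omega>. (1 - d / 2) * (real (X k \<omega>))\<^sup>2 + c0 \<partial>M)"
      by (rule integral_mono) (use sq XI pt in \<open>auto simp: power2_sum power_mult_distrib\<close>)
    also have "\<dots> = (1 - d / 2) * (\<integral>\<omega>. (real (X k \<omega>))\<^sup>2 \<partial>M) + c0"
      using sq by (simp add: prob_space)
    also have "\<dots> \<le> (1 - d / 2) * B + c0"
    proof (intro add_right_mono mult_left_mono)
      have "- 1 \<le> \<alpha>\<^sup>2" by (rule order_trans[of _ 0]) simp_all
      then show "0 \<le> 1 - d / 2" by (simp add: d_def)
    qed (use Suc in simp)
    also have "\<dots> = B - d / 2 * (\<integral>\<omega>. (real (X0 \<omega>))\<^sup>2 \<partial>M)"
      using d by (simp add: B_def field_simps)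
    also have "\<dots> \<le> B" using d by simp
    finally show ?case using X_square_step(1)[OF sq] by simp
  qed
  with B show thesis using that by blast
qed

text \<open>Markov's inequality for the squares at level \<open>real (Suc k) powr (3 / 2)\<close>
  gives summable probabilities from bounded second moments. Fourth and third powers express the
  threshold within the natural numbers.\<close>

lemma AE_X_small: "AE \<omega> in M. \<forall>\<^sub>F k in sequentially. X k \<omega> ^ 4 \<le> Suc k ^ 3"
proof -
  obtain B where B: "B \<ge> 0" "\<And>k. integrable M (\<lambda>\<omega>. (real (X k \<omega>))\<^sup>2)"
    "\<And>k. (\<integral>\<omega>. (real (X k \<omega>))\<^sup>2 \<partial>M) \<le> B" by (rule X_square_bounded) blast
  define A where "A k = {\<omega>\<in>space M. real (Suc k) powr (3 / 2) \<le> (real (X k \<omega>))\<^sup>2}" for k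
  have A: "A k \<in> events" for k unfolding A_def by measurable
  have pA: "prob (A k) \<le> B * real (Suc k) powr (- (3 / 2))" for k
  proof -
    have "prob (A k) \<le> (\<integral>\<omega>. (real (X k \<omega>))\<^sup>2 \<partial>M) / real (Suc k) powr (3 / 2)"
      unfolding A_def by (rule integral_Markov_inequality_measure[OF B(2), of "{}"]) auto
    also have "\<dots> \<le> B / real (Suc k) powr (3 / 2)"
      by (rule divide_right_mono[OF B(3)]) simp
    also have "\<dots> = B * real (Suc k) powr (- (3 / 2))" by (simp only: powr_minus_divide) simp
    finally show ?thesis .
  qed
  have "summable (\<lambda>k. B * real (Suc k) powr (- (3 / 2)))"
    by (intro summable_mult) (subst summable_Suc_iff, simp add: summable_real_powr_iff)
  then have "summable (\<lambda>k. prob (A k))"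
    by (rule summable_comparison_test'[where N = 0])
      (simp only: real_norm_def abs_of_nonneg[OF measure_nonneg] pA)
  then have "AE \<omega> in M. \<forall>\<^sub>F k in sequentially. \<omega> \<in> space M - A k"
    by (intro borel_cantelli_AE1 A) (auto simp: emeasure_eq_measure)
  then show ?thesis
  proof (rule AE_mp, intro AE_I2 impI)
    fix \<omega> assume "\<forall>\<^sub>F k in sequentially. \<omega> \<in> space M - A k"
    then show "\<forall>\<^sub>F k in sequentially. X k \<omega> ^ 4 \<le> Suc k ^ 3"
    proof eventually_elim
      case (elim k)
      then have "(real (X k \<omega>))\<^sup>2 \<le> real (Suc k) powr (3 / 2)" by (auto simp: A_def)
      then have "((real (X k \<omega>))\<^sup>2)\<^sup>2 \<le> (real (Suc k) powr (3 / 2))\<^sup>2" by (rule power_mono) simp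
      also have "\<dots> = real (Suc k) powr 3" by (simp add: powr_power)
      also have "\<dots> = real (Suc k) ^ 3" by (simp add: powr_numeral)
      finally have "real (X k \<omega> ^ 4) \<le> real (Suc k ^ 3)" by (simp flip: power_mult)
      then show ?case by (simp only: of_nat_le_iff)
    qed
  qed
qed

text \<open>Without a third moment the products \<open>X k * z k\<close> need not be square integrable. Truncating at
  \<open>X k ^ 4 \<le> Suc k ^ 3\<close> is harmless by Borel--Cantelli, since the second moments are bounded, and
  leaves variances of order \<open>k powr (3/4)\<close>.\<close>
lemma weighted_noise_average:
  fixes \<phi> :: "nat \<Rightarrow> real"
  assumes \<phi>: "\<And>x. (\<phi> x)\<^sup>2 \<le> 1 + (real x)\<^sup>2"
  shows "AE \<omega> in M. (\<lambda>n. (\<Sum>k<n. \<phi> (X k \<omega>) * z k \<omega>) / real n) \<longlonglongrightarrow> 0"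
proof -
  obtain B where B: "B \<ge> 0" "\<And>k. integrable M (\<lambda>\<omega>. (real (X k \<omega>))\<^sup>2)"
    "\<And>k. (\<integral>\<omega>. (real (X k \<omega>))\<^sup>2 \<partial>M) \<le> B" by (rule X_square_bounded) blast
  \<comment> \<open>\<open>\<phi>\<close> stands for the two weights wanted, the constant 1 and the
    identity; the indicator makes the weight bounded for each fixed \<open>k\<close>.\<close>
  define w where "w k \<omega> = of_bool (X k \<omega> ^ 4 \<le> Suc k ^ 3) * \<phi> (X k \<omega>)" for k \<omega>
  have wF: "w k \<in> borel_measurable (F k)" for k
  proof -
    note [measurable] = X_meas
    show ?thesis unfolding w_def[abs_def] by measurable
  qed
  \<comment> \<open>The truncation also implies \<open>X k \<le> Suc k\<close>, which supplies the
    cut-off \<open>K = Suc k\<close> demanded by the noise lemmas.\<close>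
  have w0: "w k \<omega> = 0" if "Suc k < X k \<omega>" for k \<omega>
  proof -
    have "Suc k ^ 3 \<le> Suc k ^ 4" by (rule power_increasing) auto
    also have "\<dots> < X k \<omega> ^ 4" using that by (rule power_strict_mono) auto
    finally show ?thesis by (simp add: w_def)
  qed
  have w2: "(w k \<omega>)\<^sup>2 \<le> 1 + (real (X k \<omega>))\<^sup>2" for k \<omega>
    using \<phi>[of "X k \<omega>"] by (simp add: w_def)
  have wb: "\<bar>w k \<omega>\<bar> \<le> 1 + real (Suc k)" for k \<omega>
  proof (cases "Suc k < X k \<omega>")
    case False
    have "(w k \<omega>)\<^sup>2 \<le> 1 + (real (X k \<omega>))\<^sup>2" by (rule w2)
    also have "\<dots> \<le> (1 + real (X k \<omega>))\<^sup>2" by (simp add: power2_sum)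
    also have "\<dots> \<le> (1 + real (Suc k))\<^sup>2" using False by (intro power_mono) auto
    finally show ?thesis by (simp add: abs_le_square_iff[symmetric])
  qed (simp add: w0)
  have [measurable]: "w k \<in> borel_measurable M" "z k \<in> borel_measurable M" for k
    using wF z_meas F_measurable_M by blast+
  interpret md: mart_diff M F "\<lambda>k \<omega>. w k \<omega> * z k \<omega>"
  proof unfold_locales
    show "subalgebra M (F n)" for n by (rule subalg_F)
    show "sets (F n) \<subseteq> sets (F (Suc n))" for n
      unfolding F_def by (rule sets_gen_mono[OF past_mono]) simp
    then show "(\<lambda>\<omega>. w n \<omega> * z n \<omega>) \<in> borel_measurable (F (Suc n))" for n
      using wF[of n] z_meas[of n] past_mono[of n "Suc n"]
      by (intro borel_measurable_times) (auto simp: F_def intro: measurable_gen_mono)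
    show "integrable M (\<lambda>\<omega>. (w n \<omega> * z n \<omega>)\<^sup>2)" for n by (rule noise_square(1)[OF wF wb w0])
    show "(\<integral>\<omega>. w n \<omega> * z n \<omega> * f \<omega> \<partial>M) = 0"
      if "f \<in> borel_measurable (F n)" "integrable M (\<lambda>\<omega>. (f \<omega>)\<^sup>2)" for f n
      by (rule noise_orth[OF wF wb w0 that(1) square_integrable_imp[OF F_measurable_M[OF that(1)] that(2)]])
  qed
  \<comment> \<open>For \<open>k < 16 ^ j\<close> the truncation yields
    \<open>X k ^ 4 \<le> (16 ^ j) ^ 3 = (8 ^ j) ^ 4\<close>, so \<open>X k \<le> 8 ^ j\<close>. The
    sum of \<open>16 ^ j\<close> such variances has the growth \<open>128 ^ j\<close> that the
    strong law admits.\<close>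
  have var: "(\<integral>\<omega>. (w k \<omega> * z k \<omega>)\<^sup>2 \<partial>M) \<le> (\<sigma>2 + 1) * 8 ^ j * (1 + B)" if "k < 16 ^ j" for k j
  proof -
    have "(\<integral>\<omega>. (w k \<omega> * z k \<omega>)\<^sup>2 \<partial>M) \<le> (\<integral>\<omega>. (w k \<omega>)\<^sup>2 * (\<sigma>2 + real (X k \<omega>)) \<partial>M)"
      by (rule noise_square(3)[OF wF wb w0])
    also have "\<dots> \<le> (\<integral>\<omega>. ((\<sigma>2 + 1) * 8 ^ j) * (1 + (real (X k \<omega>))\<^sup>2) \<partial>M)"
    proof (rule integral_mono)
      show "integrable M (\<lambda>\<omega>. (w k \<omega>)\<^sup>2 * (\<sigma>2 + real (X k \<omega>)))"
        by (rule noise_square(2)[OF wF wb w0])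
      show "integrable M (\<lambda>\<omega>. ((\<sigma>2 + 1) * 8 ^ j) * (1 + (real (X k \<omega>))\<^sup>2))" using B(2) by simp
      show "(w k \<omega>)\<^sup>2 * (\<sigma>2 + real (X k \<omega>)) \<le> ((\<sigma>2 + 1) * 8 ^ j) * (1 + (real (X k \<omega>))\<^sup>2)" for \<omega>
      proof (cases "X k \<omega> ^ 4 \<le> Suc k ^ 3")
        case True
        also have "Suc k ^ 3 \<le> (16 ^ j) ^ 3" using that by (intro power_mono) auto
        also have "(16 ^ j) ^ 3 = (8 ^ j :: nat) ^ 4"
        proof -
          have "(a ^ j) ^ i = (a ^ i) ^ j" for a i :: nat
            by (simp only: power_mult[symmetric] mult.commute)
          from this[of 16 3] this[of 8 4] show ?thesis by simp
        qed
        finally have "X k \<omega> \<le> 8 ^ j" by (rule power_le_imp_le_base[where n = 3, simplified]) simp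
        then have "real (X k \<omega>) \<le> real (8 ^ j)" by (rule of_nat_mono)
        then have X: "real (X k \<omega>) \<le> 8 ^ j" by simp
        have "1 \<le> (8::real) ^ j" by simp
        from mult_left_mono[OF this \<sigma>2_nonneg] have "\<sigma>2 \<le> \<sigma>2 * 8 ^ j" by simp
        with X have "\<sigma>2 + real (X k \<omega>) \<le> (\<sigma>2 + 1) * 8 ^ j"
          unfolding distrib_right by linarith
        then have "(w k \<omega>)\<^sup>2 * (\<sigma>2 + real (X k \<omega>)) \<le> (1 + (real (X k \<omega>))\<^sup>2) * ((\<sigma>2 + 1) * 8 ^ j)"
          using w2[of k \<omega>] \<sigma>2_nonneg by (intro mult_mono) auto
        then show ?thesis by (simp add: mult.commute)
      next
        case False
        then have "w k \<omega> = 0" by (simp add: w_def)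
        then show ?thesis using \<sigma>2_nonneg by simp
      qed
    qed
    also have "\<dots> = (\<sigma>2 + 1) * 8 ^ j * (1 + (\<integral>\<omega>. (real (X k \<omega>))\<^sup>2 \<partial>M))"
      using B(2) by (simp add: prob_space)
    also have "\<dots> \<le> (\<sigma>2 + 1) * 8 ^ j * (1 + B)"
      using B(3) \<sigma>2_nonneg by (intro mult_left_mono add_left_mono) auto
    finally show ?thesis .
  qed
  have "AE \<omega> in M. (\<lambda>n. (\<Sum>k<n. w k \<omega> * z k \<omega>) / real n) \<longlonglongrightarrow> 0"
  proof (rule md.strong_law)
    fix j
    have "(\<Sum>k<16 ^ j. \<integral>\<omega>. (w k \<omega> * z k \<omega>)\<^sup>2 \<partial>M) \<le> (\<Sum>k<(16::nat) ^ j. (\<sigma>2 + 1) * 8 ^ j * (1 + B))"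
      by (rule sum_mono) (use var in simp)
    also have "\<dots> = (\<sigma>2 + 1) * (1 + B) * (16 ^ j * 8 ^ j)" by simp
    also have "(16 ^ j * 8 ^ j :: real) = 128 ^ j" by (simp flip: power_mult_distrib)
    finally show "(\<Sum>k<16 ^ j. \<integral>\<omega>. (w k \<omega> * z k \<omega>)\<^sup>2 \<partial>M) \<le> (\<sigma>2 + 1) * (1 + B) * 128 ^ j" .
  qed
  with AE_X_small show ?thesis
  proof eventually_elim
    case (elim \<omega>)
    show ?case
      by (rule Cesaro_cong[OF _ elim(2)]) (use elim(1) in \<open>auto elim!: eventually_mono simp: w_def\<close>)
  qed
qed

section \<open>Frequency of the jumps of the path\<close>

definition remainder :: "nat \<Rightarrow> 'w \<Rightarrow> nat" where
  "remainder k \<omega> = (\<Sum>j=2..X k \<omega>. xi (Suc k) j \<omega>) + eps (Suc k) \<omega>"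

text \<open>When \<open>X k \<ge> 1\<close> the first Bernoulli variable alone decides whether \<open>X (Suc k) = X k\<close> is
  possible: a jump is forced by its value \<open>0\<close> if \<open>Suc (remainder k) = X k\<close>, and by its value \<open>1\<close>
  otherwise. Hence a jump has conditional probability at least \<open>min \<alpha> (1 - \<alpha>)\<close>.\<close>

definition flip :: "nat \<Rightarrow> 'w \<Rightarrow> real" where
  "flip k \<omega> = of_bool (1 \<le> X k \<omega>) * (if Suc (remainder k \<omega>) = X k \<omega> then - 1 else 1)"

text \<open>The jump indicator dominates this martingale difference plus a positive constant. At
  \<open>X k = 0\<close> a jump happens exactly when the innovation is nonzero, which has
  probability \<open>q\<close>; otherwise the sign in \<open>flip\<close> selects the value of the
  first Bernoulli variable that forces a jump.\<close>

definition jump_noise :: "nat \<Rightarrow> 'w \<Rightarrow> real" where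
  "jump_noise k \<omega> = (of_bool (eps (Suc k) \<omega> \<noteq> 0) - q) * of_bool (X k \<omega> = 0)
     + (real (xi (Suc k) 1 \<omega>) - \<alpha>) * flip k \<omega>"

lemma jump_lower_bound:
  assumes "xi (Suc k) 1 \<omega> \<le> 1"
  shows "jump_noise k \<omega> + min q (min \<alpha> (1 - \<alpha>)) \<le> of_bool (X (Suc k) \<omega> \<noteq> X k \<omega>)"
proof (cases "X k \<omega> = 0")
  case True
  then show ?thesis by (auto simp: jump_noise_def flip_def)
next
  case False
  then have "{1..X k \<omega>} = insert 1 {2..X k \<omega>}" by auto
  then have "X (Suc k) \<omega> = xi (Suc k) 1 \<omega> + remainder k \<omega>"
    by (simp add: remainder_def)
  moreover have "xi (Suc k) 1 \<omega> = 0 \<or> xi (Suc k) 1 \<omega> = 1" using assms by linarith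
  ultimately show ?thesis
    using False by (auto simp: jump_noise_def flip_def)
qed

text \<open>Everything up to step \<open>Suc k\<close> except the first Bernoulli variable of that
  step. \<open>flip\<close> depends on the innovation and on the other Bernoulli variables of the
  same step, so \<open>past k\<close> would be too small for it.\<close>

definition past1 :: "nat \<Rightarrow> inar_idx set" where
  "past1 k = past k \<union> {Eps (Suc k)} \<union> {Xi (Suc k) j | j. 2 \<le> j}"

lemma past1_subset: "past1 k \<subseteq> inar_index_set"
  using past_subset by (auto simp: past1_def)

lemma past1_past_Suc: "past1 k \<subseteq> past (Suc k)"
  by (auto simp: past1_def past_def)

lemma past_past1: "past k \<subseteq> past1 k"
  by (auto simp: past1_def)

lemma flip_meas: "flip k \<in> borel_measurable (gen fam (past1 k))"
proof -
  let ?G = "gen fam (past1 k)"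
  have [measurable]: "X k \<in> measurable ?G (count_space UNIV)"
    by (rule measurable_gen_mono[OF past_past1 X_meas[unfolded F_def]])
  have e: "eps (Suc k) \<in> borel_measurable ?G"
    using measurable_gen_component[of "Eps (Suc k)" "past1 k" fam]
    by (simp add: past1_def measurable_count_space_nat_iff)
  have x: "xi (Suc k) j \<in> borel_measurable ?G" if "j \<in> {2..n}" for j n
    using measurable_gen_component[of "Xi (Suc k) j" "past1 k" fam] that
    by (simp add: past1_def measurable_count_space_nat_iff)
  have "(\<lambda>\<omega>. (\<lambda>n \<omega>. (\<Sum>j=2..n. xi (Suc k) j \<omega>) + eps (Suc k) \<omega>) (X k \<omega>) \<omega>)
      \<in> measurable ?G (count_space UNIV)"
  proof (rule measurable_compose_countable[where g = "X k"
        and f = "\<lambda>n \<omega>. (\<Sum>j=2..n. xi (Suc k) j \<omega>) + eps (Suc k) \<omega>"])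
    show "(\<lambda>\<omega>. (\<Sum>j=2..n. xi (Suc k) j \<omega>) + eps (Suc k) \<omega>) \<in> measurable ?G (count_space UNIV)" for n
      unfolding measurable_count_space_nat_iff
      by (intro borel_measurable_add borel_measurable_sum e x)
  qed fact
  then have [measurable]: "remainder k \<in> measurable ?G (count_space UNIV)"
    by (simp add: remainder_def[abs_def])
  have "(\<lambda>\<omega>. (\<lambda>n \<omega>. of_bool (1 \<le> n) * (if Suc (remainder k \<omega>) = n then - 1 else 1)) (X k \<omega>) \<omega>)
      \<in> borel_measurable ?G"
    by (rule measurable_compose_countable[where g = "X k"
          and f = "\<lambda>n \<omega>. of_bool (1 \<le> n) * (if Suc (remainder k \<omega>) = n then - 1 else 1)"]) measurable
  then show ?thesis by (simp add: flip_def[abs_def])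
qed

lemma flip_bound: "\<bar>flip k \<omega>\<bar> \<le> 1"
  by (simp add: flip_def)

text \<open>The weight \<open>flip\<close> is not known at time \<open>k\<close>, but it is
  independent of the Bernoulli variable it multiplies; pulling that variable out against
  \<open>past1\<close> still gives orthogonality to \<open>F k\<close>. The second moments are
  bounded, well within the growth that the strong law allows.\<close>

lemma jump_noise_average: "AE \<omega> in M. (\<lambda>n. (\<Sum>k<n. jump_noise k \<omega>) / real n) \<longlonglongrightarrow> 0"
proof -
  define a where "a k \<omega> = (of_bool (eps (Suc k) \<omega> \<noteq> 0) - q) * of_bool (X k \<omega> = 0)" for k \<omega>
  define b where "b k \<omega> = (real (xi (Suc k) 1 \<omega>) - \<alpha>) * flip k \<omega>" for k \<omega>
  have ab: "jump_noise k \<omega> = a k \<omega> + b k \<omega>" for k \<omega> by (simp add: jump_noise_def a_def b_def)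
  have fm: "flip k \<in> borel_measurable M" for k
    by (rule measurable_from_subalg[OF subalg_gen[OF past1_subset] flip_meas])
  have q: "0 \<le> q" "q \<le> 1" by (auto simp: q_def)
  have a1: "\<bar>a k \<omega>\<bar> \<le> 1" for k \<omega> using q by (auto simp: a_def)
  have aM [measurable]: "a k \<in> borel_measurable M" for k unfolding a_def[abs_def] by measurable
  have bM [measurable]: "b k \<in> borel_measurable M" for k
  proof -
    note [measurable] = fm xi_meas[of "Suc k" 1, simplified]
    show ?thesis unfolding b_def[abs_def] by measurable
  qed
  have a2: "(a k \<omega>)\<^sup>2 \<le> 1" for k \<omega> using a1[of k \<omega>] by (simp add: abs_square_le_1)
  have aI: "integrable M (\<lambda>\<omega>. (a k \<omega>)\<^sup>2)" for k
    by (rule bounded_integrable[where B = 1]) (use a2 in auto)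
  have xs: "integrable M (\<lambda>\<omega>. (real (xi (Suc k) 1 \<omega>) - \<alpha>)\<^sup>2)"
      "(\<integral>\<omega>. (real (xi (Suc k) 1 \<omega>) - \<alpha>)\<^sup>2 \<partial>M) \<le> 1" for k
    using xi_centred[of "Suc k" 1] by auto
  have b2: "(b k \<omega>)\<^sup>2 \<le> (real (xi (Suc k) 1 \<omega>) - \<alpha>)\<^sup>2" for k \<omega>
    by (simp add: b_def flip_def power2_commute)
  have bI: "integrable M (\<lambda>\<omega>. (b k \<omega>)\<^sup>2)" for k
    by (rule Bochner_Integration.integrable_bound[OF xs(1)]) (use b2 in auto)
  have abI: "integrable M (\<lambda>\<omega>. (jump_noise k \<omega>)\<^sup>2)" for k
    unfolding ab by (rule square_integrable_add[OF aM bM aI bI])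
  interpret md: mart_diff M F jump_noise
  proof unfold_locales
    show "subalgebra M (F n)" for n by (rule subalg_F)
    show "sets (F n) \<subseteq> sets (F (Suc n))" for n
      unfolding F_def by (rule sets_gen_mono[OF past_mono]) simp
    show "jump_noise n \<in> borel_measurable (F (Suc n))" for n
    proof -
      have [measurable]: "X n \<in> measurable (F (Suc n)) (count_space UNIV)"
        using X_meas[of n] past_mono[of n "Suc n"] unfolding F_def by (auto intro: measurable_gen_mono)
      have [measurable]: "flip n \<in> borel_measurable (F (Suc n))"
        unfolding F_def by (rule measurable_gen_mono[OF past1_past_Suc flip_meas])
      have [measurable]: "eps (Suc n) \<in> measurable (F (Suc n)) (count_space UNIV)"
        using measurable_gen_component[of "Eps (Suc n)" "past (Suc n)" fam] by (simp add: past_def F_def)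
      have [measurable]: "xi (Suc n) 1 \<in> measurable (F (Suc n)) (count_space UNIV)"
        using measurable_gen_component[of "Xi (Suc n) 1" "past (Suc n)" fam] by (simp add: past_def F_def)
      show ?thesis unfolding jump_noise_def[abs_def] by measurable
    qed
    show "integrable M (\<lambda>\<omega>. (jump_noise n \<omega>)\<^sup>2)" for n by (rule abI)
    show "(\<integral>\<omega>. jump_noise n \<omega> * f \<omega> \<partial>M) = 0"
      if f: "f \<in> borel_measurable (F n)" "integrable M (\<lambda>\<omega>. (f \<omega>)\<^sup>2)" for f n
    proof -
      have fM [measurable]: "f \<in> borel_measurable M" by (rule F_measurable_M[OF f(1)])
      have f0: "(\<lambda>\<omega>. of_bool (X n \<omega> = 0) * f \<omega>) \<in> borel_measurable (gen fam (past n))"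
      proof -
        note [measurable] = X_meas[of n, unfolded F_def] f(1)[unfolded F_def]
        show ?thesis by measurable
      qed
      have f0I: "integrable M (\<lambda>\<omega>. of_bool (X n \<omega> = 0) * f \<omega>)"
        by (rule square_integrable_imp[OF _ square_integrable_bounded_mult[OF _ fM f(2), where B = 1]]) auto
      have ne: "Eps (Suc n) \<notin> past n" by (auto simp: past_def)
      have eI: "integrable M (\<lambda>\<omega>. of_bool (eps (Suc n) \<omega> \<noteq> 0) - q)"
        by (rule bounded_integrable[where B = 1]) (use q in \<open>auto\<close>)
      have A: "integrable M (\<lambda>\<omega>. a n \<omega> * f \<omega>)" "(\<integral>\<omega>. a n \<omega> * f \<omega> \<partial>M) = 0"
        using integrable_gen_mult[OF indep past_subset _ ne f0, of "\<lambda>m. of_bool (m \<noteq> 0) - q"]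
          expectation_gen_mult[OF indep past_subset _ ne f0, of "\<lambda>m. of_bool (m \<noteq> 0) - q"]
          eI f0I eps_nz_centred[of "Suc n"]
        by (simp_all add: a_def mult.assoc)
      have g: "(\<lambda>\<omega>. flip n \<omega> * f \<omega>) \<in> borel_measurable (gen fam (past1 n))"
        by (intro borel_measurable_times flip_meas measurable_gen_mono[OF past_past1 f(1)[unfolded F_def]])
      have gI: "integrable M (\<lambda>\<omega>. flip n \<omega> * f \<omega>)"
        by (rule square_integrable_imp[OF _ square_integrable_bounded_mult[OF fm fM f(2) flip_bound]])
          (intro borel_measurable_times fm fM)
      have nx: "Xi (Suc n) 1 \<notin> past1 n" by (auto simp: past_def past1_def)
      have Bf: "integrable M (\<lambda>\<omega>. b n \<omega> * f \<omega>)" "(\<integral>\<omega>. b n \<omega> * f \<omega> \<partial>M) = 0"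
        using xi_orth[OF past1_subset nx _ g gI] by (simp_all add: b_def mult.assoc)
      show ?thesis unfolding ab distrib_right using A Bf by simp
    qed
  qed
  have var: "(\<integral>\<omega>. (jump_noise k \<omega>)\<^sup>2 \<partial>M) \<le> 4" for k
  proof -
    have "(\<integral>\<omega>. (jump_noise k \<omega>)\<^sup>2 \<partial>M) \<le> (\<integral>\<omega>. 2 + 2 * (real (xi (Suc k) 1 \<omega>) - \<alpha>)\<^sup>2 \<partial>M)"
    proof (rule integral_mono[OF abI])
      show "integrable M (\<lambda>\<omega>. 2 + 2 * (real (xi (Suc k) 1 \<omega>) - \<alpha>)\<^sup>2)" using xs by simp
      show "(jump_noise k \<omega>)\<^sup>2 \<le> 2 + 2 * (real (xi (Suc k) 1 \<omega>) - \<alpha>)\<^sup>2" for \<omega>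
        unfolding ab using square_sum_le[of "a k \<omega>" "b k \<omega>"] a2[of k \<omega>] b2[of k \<omega>] by linarith
    qed
    also have "\<dots> = 2 + 2 * (\<integral>\<omega>. (real (xi (Suc k) 1 \<omega>) - \<alpha>)\<^sup>2 \<partial>M)"
      using xs(1) by (simp add: prob_space)
    also have "\<dots> \<le> 4" using xs(2)[of k] by simp
    finally show ?thesis .
  qed
  show ?thesis
  proof (rule md.strong_law)
    fix j
    have "(\<Sum>k<16 ^ j. \<integral>\<omega>. (jump_noise k \<omega>)\<^sup>2 \<partial>M) \<le> (\<Sum>k<(16::nat) ^ j. 4)"
      by (rule sum_mono) (rule var)
    also have "\<dots> = 4 * 16 ^ j" by simp
    also have "\<dots> \<le> 4 * (128::real) ^ j" by (intro mult_left_mono power_mono) auto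
    finally show "(\<Sum>k<16 ^ j. \<integral>\<omega>. (jump_noise k \<omega>)\<^sup>2 \<partial>M) \<le> 4 * 128 ^ j" .
  qed
qed

lemma jump_frequency:
  obtains p where "p > 0"
    "AE \<omega> in M. \<forall>\<^sub>F n in sequentially. p * real n \<le> (\<Sum>k<n. of_bool (X (Suc k) \<omega> \<noteq> X k \<omega>))"
proof -
  define p where "p = min q (min \<alpha> (1 - \<alpha>))"
  have p: "p > 0" using \<alpha> eps_nz by (auto simp: p_def q_def)
  have le: "AE \<omega> in M. \<forall>k. xi (Suc k) 1 \<omega> \<le> 1"
    unfolding AE_all_countable using xi_le[of "Suc _" 1] by auto
  \<comment> \<open>Half of \<open>p\<close> is given up to the noise average, which is eventually
    above \<open>- (p / 2)\<close>.\<close>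
  have "AE \<omega> in M. \<forall>\<^sub>F n in sequentially. p / 2 * real n \<le> (\<Sum>k<n. of_bool (X (Suc k) \<omega> \<noteq> X k \<omega>))"
    using le jump_noise_average
  proof eventually_elim
    case (elim \<omega>)
    have "\<forall>\<^sub>F n in sequentially. - (p / 2) < (\<Sum>k<n. jump_noise k \<omega>) / real n"
      by (rule order_tendstoD(1)[OF elim(2)]) (use p in simp)
    then show ?case
      using eventually_gt_at_top[of 0]
    proof eventually_elim
      case (elim n)
      then have "- (p / 2) * real n < (\<Sum>k<n. jump_noise k \<omega>)" by (simp add: field_simps)
      moreover have "(\<Sum>k<n. jump_noise k \<omega> + p) \<le> (\<Sum>k<n. of_bool (X (Suc k) \<omega> \<noteq> X k \<omega>))"
        unfolding p_def
        by (rule sum_mono) (rule jump_lower_bound, use \<open>\<forall>k. xi (Suc k) 1 \<omega> \<le> 1\<close> in blast)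
      moreover have "(\<Sum>k<n. jump_noise k \<omega> + p) = (\<Sum>k<n. jump_noise k \<omega>) + p * real n"
        by (simp add: sum.distrib)
      ultimately show ?case by argo
    qed
  qed
  with p show thesis using that[of "p / 2"] by simp
qed

text \<open>The sum of the \<open>z k\<close> telescopes into \<open>1 - \<alpha>\<close> times the
  sum of the \<open>X k\<close>, minus \<open>n * \<mu>\<close>, plus \<open>X n - X 0\<close>, and
  \<open>X n \<ge> 0\<close> may be dropped. In \<open>\<mu> + 2\<close>, one unit pays for the
  noise average and one for \<open>X 0 < n\<close>.\<close>

lemma average_bounded:
  assumes "(\<lambda>n. (\<Sum>k<n. z k \<omega>) / real n) \<longlonglongrightarrow> 0"
  shows "\<forall>\<^sub>F n in sequentially. (\<Sum>k<n. \<bar>real (X k \<omega>)\<bar>) \<le> (\<mu> + 2) / (1 - \<alpha>) * real n"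
proof -
  have "\<forall>\<^sub>F n in sequentially. (\<Sum>k<n. z k \<omega>) / real n < 1"
    by (rule order_tendstoD(2)[OF assms]) simp
  then show ?thesis
    using eventually_gt_at_top[of "X 0 \<omega>"]
  proof eventually_elim
    case (elim n)
    have "(\<Sum>k<n. real (X (Suc k) \<omega>)) = (\<Sum>k<n. real (X k \<omega>)) + real (X n \<omega>) - real (X 0 \<omega>)"
      using sum_lessThan_telescope[of "\<lambda>k. real (X k \<omega>)" n] by (simp add: sum_subtractf)
    moreover have "(\<Sum>k<n. z k \<omega>) = (\<Sum>k<n. real (X (Suc k) \<omega>)) - \<alpha> * (\<Sum>k<n. real (X k \<omega>)) - real n * \<mu>"
      unfolding z_def sum_subtractf sum_distrib_left by simp
    ultimately have "(\<Sum>k<n. z k \<omega>) = (1 - \<alpha>) * (\<Sum>k<n. real (X k \<omega>)) + real (X n \<omega>) - real (X 0 \<omega>) - real n * \<mu>"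
      by (simp only: left_diff_distrib)
    moreover have "(\<Sum>k<n. z k \<omega>) < real n" using elim by (simp add: field_simps)
    moreover have "real (X 0 \<omega>) \<le> real n" using elim(2) by simp
    moreover have "0 \<le> real (X n \<omega>)" by simp
    ultimately have "(1 - \<alpha>) * (\<Sum>k<n. real (X k \<omega>)) \<le> (\<mu> + 2) * real n"
      unfolding distrib_right mult.commute[of \<mu>] by argo
    then show ?case using \<alpha> by (simp add: field_simps)
  qed
qed

end

section \<open>From the process to the contaminated observations\<close>

lemma abs_diff_nat_ge_one: "m \<noteq> n \<Longrightarrow> 1 \<le> \<bar>real m - real n\<bar>"
  by (cases m n rule: linorder_cases) auto

text \<open>The least squares sum starts at 1, uses the lagged index \<open>k - 1\<close> and omits
  \<open>E\<close>. Replacing the omitted terms by 0 changes only finitely many summands, which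
  averages do not see.\<close>

lemma shifted_Cesaro:
  fixes a :: "nat \<Rightarrow> real"
  assumes "finite E" and a: "(\<lambda>n. (\<Sum>k<n. a k) / real n) \<longlonglongrightarrow> 0"
  shows "(\<lambda>n. (\<Sum>k\<in>{1..n} - E. a (k - 1)) / real n) \<longlonglongrightarrow> 0"
proof -
  define b where "b k = (if Suc k \<in> E then 0 else a k)" for k
  have "\<forall>\<^sub>F k in sequentially. a k = b k"
    using eventually_gt_at_top[of "Max (insert 0 E)"]
  proof eventually_elim
    case (elim k)
    then have "Suc k \<notin> E" using assms(1) by (auto dest: Max_ge[of "insert 0 E" "Suc k", rotated])
    then show ?case by (simp add: b_def)
  qed
  then have "(\<lambda>n. (\<Sum>k<n. b k) / real n) \<longlonglongrightarrow> 0" by (rule Cesaro_cong[OF _ a])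
  moreover have "(\<Sum>k\<in>{1..n} - E. a (k - 1)) = (\<Sum>k<n. b k)" for n
  proof -
    have "(\<Sum>k\<in>{1..n} - E. a (k - 1)) = (\<Sum>k\<in>{1..n}. b (k - 1))"
      by (rule sum.mono_neutral_cong_left) (auto simp: b_def)
    also have "\<dots> = (\<Sum>k<n. b k)"
      by (rule sum.reindex_bij_witness[of _ Suc "\<lambda>k. k - 1"]) auto
    finally show ?thesis .
  qed
  ultimately show ?thesis by simp
qed

theorem theorem3p6p1:
  fixes M :: "'w measure"
    and \<alpha> :: real
    and X0 :: "'w \<Rightarrow> nat"
    and eps :: "nat \<Rightarrow> 'w \<Rightarrow> nat"
    and xi :: "nat \<Rightarrow> nat \<Rightarrow> 'w \<Rightarrow> nat"
    and s1 s2 \<theta>1 \<theta>2 :: nat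
  assumes "prob_space M"
    and "0 < \<alpha>" and "\<alpha> < 1"
    and "prob_space.indep_vars M (\<lambda>_. count_space UNIV) (inar_family X0 eps xi) inar_index_set"
    and "\<And>k. 1 \<le> k \<Longrightarrow>
           distr M (count_space UNIV) (eps k) = distr M (count_space UNIV) (eps 1)"
    and "integrable M (\<lambda>\<omega>. (real (eps 1 \<omega>))\<^sup>2)"
    and "measure M {\<omega> \<in> space M. eps 1 \<omega> \<noteq> 0} > 0"
    and "\<And>k j. 1 \<le> k \<Longrightarrow> 1 \<le> j \<Longrightarrow> (AE \<omega> in M. xi k j \<omega> \<le> 1)"
    and "\<And>k j. 1 \<le> k \<Longrightarrow> 1 \<le> j \<Longrightarrow> measure M {\<omega> \<in> space M. xi k j \<omega> = 1} = \<alpha>"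
    and "integrable M (\<lambda>\<omega>. (real (X0 \<omega>))\<^sup>2)"
    and "1 \<le> s1" and "s1 < s2 - 1"
    and "1 \<le> \<theta>1" and "1 \<le> \<theta>2"
  shows
    "(AE \<omega> in M. \<exists>n0. \<forall>n\<ge>n0. \<exists>!p. \<forall>q.
        Qn4 s1 s2 n (\<lambda>k. real (inarY X0 eps xi s1 s2 \<theta>1 \<theta>2 k \<omega>)) p
        \<le> Qn4 s1 s2 n (\<lambda>k. real (inarY X0 eps xi s1 s2 \<theta>1 \<theta>2 k \<omega>)) q)
     \<and> (let \<mu> = (\<integral>\<omega>. real (eps 1 \<omega>) \<partial>M);
            Y = (\<lambda>\<omega> k. real (inarY X0 eps xi s1 s2 \<theta>1 \<theta>2 k \<omega>));
            est = (\<lambda>n \<omega>. CLSE s1 s2 n (Y \<omega>));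
            lim\<theta> = (\<lambda>\<omega> s. Y \<omega> s - \<alpha> / (1 + \<alpha>\<^sup>2) * (Y \<omega> (s - 1) + Y \<omega> (s + 1))
                              - (1 - \<alpha>) / (1 + \<alpha>\<^sup>2) * \<mu>)
        in (AE \<omega> in M. (\<lambda>n. fst (est n \<omega>)) \<longlonglongrightarrow> \<alpha>)
         \<and> (AE \<omega> in M. (\<lambda>n. fst (snd (est n \<omega>))) \<longlonglongrightarrow> \<mu>)
         \<and> (AE \<omega> in M. (\<lambda>n. fst (snd (snd (est n \<omega>)))) \<longlonglongrightarrow> lim\<theta> \<omega> s1)
         \<and> (AE \<omega> in M. (\<lambda>n. snd (snd (snd (est n \<omega>)))) \<longlonglongrightarrow> lim\<theta> \<omega> s2))"
proof -
  interpret prob_space M by fact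
  interpret I: inar M \<alpha> X0 eps xi
    by unfold_locales (use assms in blast)+
  define E where "E = {s1, s1 + 1, s2, s2 + 1}"
  define Y where "Y \<omega> k = real (inarY X0 eps xi s1 s2 \<theta>1 \<theta>2 k \<omega>)" for \<omega> k
  have finE: "finite E" by (simp add: E_def)
  \<comment> \<open>Omitting both \<open>s\<close> and \<open>s + 1\<close> for each outlier
    position \<open>s\<close> is exactly what makes \<open>Y\<close> agree with \<open>X\<close> at
    \<open>k\<close> and at the lag \<open>k - 1\<close>.\<close>
  have Y: "Y \<omega> k = real (I.X k \<omega>)" "Y \<omega> (k - 1) = real (I.X (k - 1) \<omega>)"
    if "k \<in> {1..n} - E" for \<omega> k n
    using that by (auto simp: Y_def E_def inarY_def)
  obtain p where p: "p > 0" "AE \<omega> in M. \<forall>\<^sub>F n in sequentially.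
      p * real n \<le> (\<Sum>k<n. of_bool (I.X (Suc k) \<omega> \<noteq> I.X k \<omega>))"
    by (rule I.jump_frequency)
  have n1: "AE \<omega> in M. (\<lambda>n. (\<Sum>k<n. I.z k \<omega>) / real n) \<longlonglongrightarrow> 0"
    using I.weighted_noise_average[of "\<lambda>_. 1"] by simp
  have n2: "AE \<omega> in M. (\<lambda>n. (\<Sum>k<n. real (I.X k \<omega>) * I.z k \<omega>) / real n) \<longlonglongrightarrow> 0"
    using I.weighted_noise_average[of real] by simp
  have main: "AE \<omega> in M. (\<exists>n0. \<forall>n\<ge>n0. \<exists>!p. \<forall>q. Qn4 s1 s2 n (Y \<omega>) p \<le> Qn4 s1 s2 n (Y \<omega>) q)
      \<and> (\<lambda>n. fst (CLSE s1 s2 n (Y \<omega>))) \<longlonglongrightarrow> \<alpha>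
      \<and> (\<lambda>n. fst (snd (CLSE s1 s2 n (Y \<omega>)))) \<longlonglongrightarrow> I.\<mu>
      \<and> (\<lambda>n. fst (snd (snd (CLSE s1 s2 n (Y \<omega>))))) \<longlonglongrightarrow>
          Y \<omega> s1 - \<alpha> / (1 + \<alpha>\<^sup>2) * (Y \<omega> (s1 - 1) + Y \<omega> (s1 + 1)) - (1 - \<alpha>) / (1 + \<alpha>\<^sup>2) * I.\<mu>
      \<and> (\<lambda>n. snd (snd (snd (CLSE s1 s2 n (Y \<omega>))))) \<longlonglongrightarrow>
          Y \<omega> s2 - \<alpha> / (1 + \<alpha>\<^sup>2) * (Y \<omega> (s2 - 1) + Y \<omega> (s2 + 1)) - (1 - \<alpha>) / (1 + \<alpha>\<^sup>2) * I.\<mu>"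
    using p(2) n1 n2
  proof eventually_elim
    case (elim \<omega>)
    let ?x = "\<lambda>k. real (I.X k \<omega>)"
    have z: "Y \<omega> k - \<alpha> * Y \<omega> (k - 1) - I.\<mu> = I.z (k - 1) \<omega>" if "k \<in> {1..n} - E" for k n
      using that unfolding Y[OF that] I.z_def by simp
    have "\<exists>l>0. \<forall>\<^sub>F n in sequentially. \<forall>a b.
        l * real n * (a\<^sup>2 + b\<^sup>2) \<le> (\<Sum>k\<in>{1..n} - E. (a * ?x (k - 1) + b)\<^sup>2)"
    proof (rule gram_lower_bound[OF finE p(1)])
      show "1 \<le> \<bar>?x (Suc k) - ?x k\<bar>" if "?x (Suc k) \<noteq> ?x k" for k
        using that abs_diff_nat_ge_one by (simp only: of_nat_eq_iff)
      show "\<forall>\<^sub>F n in sequentially. p * real n \<le> (\<Sum>k<n. of_bool (?x (Suc k) \<noteq> ?x k))"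
        using elim(1) by (simp only: of_nat_eq_iff)
      show "\<forall>\<^sub>F n in sequentially. (\<Sum>k<n. \<bar>?x k\<bar>) \<le> (I.\<mu> + 2) / (1 - \<alpha>) * real n"
        by (rule I.average_bounded[OF elim(2)])
    qed
    then obtain l where l: "l > 0" "\<forall>\<^sub>F n in sequentially. \<forall>a b.
        l * real n * (a\<^sup>2 + b\<^sup>2) \<le> (\<Sum>k\<in>{1..n} - E. (a * ?x (k - 1) + b)\<^sup>2)" by blast
    have eq: "(\<Sum>k\<in>{1..n} - E. (a * Y \<omega> (k - 1) + b)\<^sup>2) = (\<Sum>k\<in>{1..n} - E. (a * ?x (k - 1) + b)\<^sup>2)" for n a b
      by (rule sum.cong[OF refl]) (simp only: Y)
    have gram: "\<forall>\<^sub>F n in sequentially. \<forall>a b.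
        l * real n * (a\<^sup>2 + b\<^sup>2) \<le> (\<Sum>k\<in>{1..n} - E. (a * Y \<omega> (k - 1) + b)\<^sup>2)"
      unfolding eq by (rule l(2))
    have eq1: "(\<Sum>k\<in>{1..n} - E. Y \<omega> k - \<alpha> * Y \<omega> (k - 1) - I.\<mu>) = (\<Sum>k\<in>{1..n} - E. I.z (k - 1) \<omega>)" for n
      by (rule sum.cong[OF refl]) (rule z)
    have N1: "(\<lambda>n. (\<Sum>k\<in>{1..n} - E. Y \<omega> k - \<alpha> * Y \<omega> (k - 1) - I.\<mu>) / real n) \<longlonglongrightarrow> 0"
      unfolding eq1 by (rule shifted_Cesaro[OF finE elim(2)])
    have eq2: "(\<Sum>k\<in>{1..n} - E. (Y \<omega> k - \<alpha> * Y \<omega> (k - 1) - I.\<mu>) * Y \<omega> (k - 1))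
        = (\<Sum>k\<in>{1..n} - E. real (I.X (k - 1) \<omega>) * I.z (k - 1) \<omega>)" for n
    proof (rule sum.cong[OF refl])
      fix k assume k: "k \<in> {1..n} - E"
      show "(Y \<omega> k - \<alpha> * Y \<omega> (k - 1) - I.\<mu>) * Y \<omega> (k - 1) = real (I.X (k - 1) \<omega>) * I.z (k - 1) \<omega>"
        by (subst z[OF k], subst Y(2)[OF k]) (rule mult.commute)
    qed
    have N2: "(\<lambda>n. (\<Sum>k\<in>{1..n} - E. (Y \<omega> k - \<alpha> * Y \<omega> (k - 1) - I.\<mu>) * Y \<omega> (k - 1)) / real n) \<longlonglongrightarrow> 0"
      unfolding eq2 by (rule shifted_Cesaro[OF finE elim(3)])
    note C = l(1) gram[unfolded E_def] N1[unfolded E_def] N2[unfolded E_def]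
    show ?case
      by (intro conjI CLSE_unique[OF C] CLSE_tendsto_alpha[OF C] CLSE_tendsto_mu[OF C]
          CLSE_tendsto_theta1[OF C] CLSE_tendsto_theta2[OF C])
  qed
  show ?thesis
    unfolding Let_def Y_def[symmetric] I.\<mu>_def[symmetric]
    by (intro conjI; rule AE_mp[OF main]; intro AE_I2 impI; elim conjE; assumption)
qed

end
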